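(* If $r > 9172$ is an integer and $r \equiv 0$ or $1 \pmod{4}$, then there exists a pentagonal geometry $\mathrm{PENT}(4,r)$ with precisely one opposite line pair.
   Context: A partial linear space is a non-empty finite set of points together with a collection of subsets, called lines (or blocks), such that every line contains at least two points and any two distinct points lie together on at most one line. Two distinct points are collinear if some line contains both. For integers $k \ge 2$, $r \ge 1$, a pentagonal geometry $\mathrm{PENT}(k,r)$ is a partial linear space in which every line contains exactly $k$ points, every point lies on exactly $r$ lines, and for each point $x$ there is a line, denoted $x^{\mathrm{opp}}$, consisting of precisely those points $y \ne x$ that are not collinear with $x$. An opposite line pair is an unordered pair of disjoint lines such that for each point $x$ on one of the two lines, $x^{\mathrm{opp}}$ is the other line. *)

theory Defs
  imports Main
begin

locale partial_linear_space =
  fixes points :: "'a set" and lines :: "'a set set"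
  assumes finite_points: "finite points"
    and points_nonempty: "points \<noteq> {}"
    and lines_subset: "\<And>L. L \<in> lines \<Longrightarrow> L \<subseteq> points"
    and two_le_card_line: "\<And>L. L \<in> lines \<Longrightarrow> 2 \<le> card L"
    and line_unique:
      "\<And>x y L M. \<lbrakk>x \<noteq> y; L \<in> lines; M \<in> lines; x \<in> L; y \<in> L; x \<in> M; y \<in> M\<rbrakk> \<Longrightarrow> L = M"
begin

definition collinear_points :: "'a \<Rightarrow> 'a \<Rightarrow> bool" where
  "collinear_points x y \<longleftrightarrow> x \<noteq> y \<and> (\<exists>L\<in>lines. x \<in> L \<and> y \<in> L)"

(* In a general partial linear space this is only a set of points;
   being a line is an axiom of pentagonal geometries. *)
definition opp :: "'a \<Rightarrow> 'a set" where
  "opp x = {y \<in> points. y \<noteq> x \<and> \<not> collinear_points x y}"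

(* Each member is the two-element set {L, M}, so pairs are unordered. *)
definition opposite_line_pairs :: "'a set set set" where
  "opposite_line_pairs =
     {{L, M} | L M. L \<in> lines \<and> M \<in> lines \<and> L \<inter> M = {} \<and>
        (\<forall>x\<in>L. opp x = M) \<and> (\<forall>x\<in>M. opp x = L)}"

end

locale pentagonal_geometry = partial_linear_space points lines
  for points :: "'a set" and lines :: "'a set set" +
  fixes k r :: nat
  assumes two_le_k: "2 \<le> k"
    and one_le_r: "1 \<le> r"
    and card_line: "\<And>L. L \<in> lines \<Longrightarrow> card L = k"
    and card_lines_through: "\<And>x. x \<in> points \<Longrightarrow> card {L \<in> lines. x \<in> L} = r"
    and opp_line: "\<And>x. x \<in> points \<Longrightarrow> opp x \<in> lines"

end

theory Submission
  imports Defs "HOL-Number_Theory.Cong" "HOL-Library.Multiset" "HOL-Library.Code_Binary_Nat"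
begin

text \<open>
  An opposite line pair occupies eight points, and removing its two lines from a \<open>PENT(4, n + 1)\<close>
  leaves a structure on \<open>3 * n\<close> points and a hole of size eight. Call \<open>n\<close> admissible if there is such
  a structure without further opposite line pairs. Truncating one group of a transversal design
  \<open>TD(5, n)\<close> to size \<open>m \<le> n\<close>, giving weight three to its points and filling the resulting groups
  of sizes \<open>3 * n\<close> and \<open>3 * m\<close> together with the common hole shows that \<open>4 * n + m\<close> is admissible
  whenever \<open>n\<close> and \<open>m\<close> are and \<open>n\<close> is coprime to \<open>6\<close>. Starting from \<open>0\<close> and from eighteen values
  realised by designs with a cyclic automorphism group, which were found by computer, this yields
  all \<open>n \<equiv> 0, 3 (mod 4)\<close> between \<open>a\<close> and \<open>5 * a + 160\<close> for \<open>a = 2460\<close>, and hence by induction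
  all larger ones.\<close>

section \<open>Pentagonal geometries with a hole\<close>

text \<open>A point of a \<open>PENT(4, r)\<close> lies on \<open>r\<close> lines with three further
  points each and is not collinear with the four points of its opposite line, so there are
  \<open>3 * r + 5\<close> points; for \<open>r = n + 1\<close> this is \<open>3 * n + 8\<close>.
  Since \<open>4 * n + m\<close> and \<open>m\<close> agree modulo 4, the truncated group decides
  the residue, while coprimality to 6 forces \<open>n\<close> to be odd and hence, among the
  residues 0 and 3 modulo 4, to be 7 or 11 modulo 12. Such \<open>n\<close> are at most 8 apart. To
  write \<open>t\<close> as \<open>4 * n + m\<close> with \<open>a \<le> m \<le> n\<close>, one
  needs \<open>n\<close> between \<open>t / 5\<close> and \<open>(t - a) / 4\<close>. This window
  has length \<open>(t - 5 * a) / 20\<close>, which reaches 8 at \<open>t = 5 * a + 160\<close>;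
  that is the origin of the upper end of the interval.\<close>

definition nonadjacent :: "'a set \<Rightarrow> 'a set set \<Rightarrow> 'a \<Rightarrow> 'a set" where
  "nonadjacent V B x = {y \<in> V. y \<noteq> x \<and> (\<forall>b\<in>B. x \<in> b \<longrightarrow> y \<notin> b)}"

text \<open>Several structures will share one hole, so no block may contain two hole points; the two
  lines on the hole are added only at the end. By symmetry of nonadjacency,
  \<open>nonadjacent_subset\<close> makes every hole point adjacent to all of \<open>X\<close>. The
  four points of a line in an opposite pair have a common opposite line, so
  \<open>inj_nonadjacent\<close> is a local condition that excludes further pairs and survives
  gluing.\<close>

locale pent_with_hole =
  fixes X H :: "'a set" and B :: "'a set set"
  assumes finite_X: "finite X"
    and disjoint: "X \<inter> H = {}"
    and block_subset: "\<And>b. b \<in> B \<Longrightarrow> b \<subseteq> X \<union> H"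
    and card_block: "\<And>b. b \<in> B \<Longrightarrow> card b = 4"
    and block_hole: "\<And>b x y. \<lbrakk>b \<in> B; x \<in> b; y \<in> b; x \<in> H; y \<in> H\<rbrakk> \<Longrightarrow> x = y"
    and block_unique:
      "\<And>b c x y. \<lbrakk>b \<in> B; c \<in> B; x \<in> b; y \<in> b; x \<in> c; y \<in> c; x \<noteq> y\<rbrakk> \<Longrightarrow> b = c"
    and nonadjacent_block: "\<And>x. x \<in> X \<Longrightarrow> nonadjacent (X \<union> H) B x \<in> B"
    and nonadjacent_subset: "\<And>x. x \<in> X \<Longrightarrow> nonadjacent (X \<union> H) B x \<subseteq> X"
    and inj_nonadjacent: "inj_on (nonadjacent (X \<union> H) B) X"

section \<open>Transport to isomorphic copies\<close>

lemma nonadjacent_image: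
  assumes f: "inj_on f V" and x: "x \<in> V" and B: "\<And>b. b \<in> B \<Longrightarrow> b \<subseteq> V"
  shows "nonadjacent (f ` V) ((`) f ` B) (f x) = f ` nonadjacent V B x"
proof -
  have "f y \<in> f ` b \<longleftrightarrow> y \<in> b" if "y \<in> V" "b \<in> B" for y b
    using that f B by (auto simp: inj_on_image_mem_iff)
  moreover have "f y = f x \<longleftrightarrow> y = x" if "y \<in> V" for y
    using f x that by (auto dest: inj_onD)
  ultimately show ?thesis
    using x unfolding nonadjacent_def by auto
qed

lemma pent_with_hole_image:
  assumes P: "pent_with_hole X H B" and f: "inj_on f (X \<union> H)"
  shows "pent_with_hole (f ` X) (f ` H) ((`) f ` B)"
proof -
  interpret pent_with_hole X H B by (rule P)
  have mem: "f y \<in> f ` b \<longleftrightarrow> y \<in> b" if "y \<in> X \<union> H" "b \<in> B" for y b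
    using inj_on_image_mem_iff[OF f that(1) block_subset[OF that(2)]] .
  have memH: "f y \<in> f ` H \<longleftrightarrow> y \<in> H" if "y \<in> X \<union> H" for y
    using inj_on_image_mem_iff[OF f that, of H] by simp
  have nb: "nonadjacent (f ` X \<union> f ` H) ((`) f ` B) (f x) = f ` nonadjacent (X \<union> H) B x" if "x \<in> X" for x
    using nonadjacent_image[OF f, of x B] that block_subset by (simp add: image_Un)
  show ?thesis
  proof (rule pent_with_hole.intro)
    show "finite (f ` X)" using finite_X by simp
    show "f ` X \<inter> f ` H = {}" using disjoint memH by auto
    show "b \<subseteq> f ` X \<union> f ` H" if "b \<in> (`) f ` B" for b
      using that image_mono[OF block_subset, of _ f] by (auto simp: image_Un)
    show "card b = 4" if "b \<in> (`) f ` B" for b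
      using that card_block card_image[OF inj_on_subset[OF f block_subset]] by auto
    show "x = y" if hyp: "b \<in> (`) f ` B" "x \<in> b" "y \<in> b" "x \<in> f ` H" "y \<in> f ` H" for b x y
    proof -
      obtain b' where b': "b' \<in> B" "b = f ` b'" using hyp(1) by blast
      obtain x' y' where "x' \<in> b'" "y' \<in> b'" "x = f x'" "y = f y'" using hyp b' by auto
      moreover from this have "x' \<in> H" "y' \<in> H" using hyp memH block_subset[OF b'(1)] by auto
      ultimately show ?thesis using block_hole[OF b'(1)] by blast
    qed
    show "b = c" if hyp: "b \<in> (`) f ` B" "c \<in> (`) f ` B" "x \<in> b" "y \<in> b" "x \<in> c" "y \<in> c" "x \<noteq> y" for b c x y
    proof -
      obtain b' where b': "b' \<in> B" "b = f ` b'" using hyp(1) by blast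
      obtain c' where c': "c' \<in> B" "c = f ` c'" using hyp(2) by blast
      obtain x' y' where "x' \<in> b'" "y' \<in> b'" "x = f x'" "y = f y'" using hyp b' by auto
      moreover from this have "x' \<in> c'" "y' \<in> c'" using hyp c' mem block_subset[OF b'(1)] by auto
      ultimately have "b' = c'" using block_unique[OF b'(1) c'(1)] hyp(7) by metis
      then show ?thesis using b' c' by simp
    qed
    show "nonadjacent (f ` X \<union> f ` H) ((`) f ` B) y \<in> (`) f ` B" if y: "y \<in> f ` X" for y
    proof -
      obtain x where "x \<in> X" "y = f x" using y by blast
      then show ?thesis using nb[of x] nonadjacent_block[of x] by auto
    qed
    show "nonadjacent (f ` X \<union> f ` H) ((`) f ` B) y \<subseteq> f ` X" if y: "y \<in> f ` X" for y
    proof -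
      obtain x where "x \<in> X" "y = f x" using y by blast
      then show ?thesis using nb[of x] image_mono[OF nonadjacent_subset[of x], of f] by simp
    qed
    show "inj_on (nonadjacent (f ` X \<union> f ` H) ((`) f ` B)) (f ` X)"
    proof (rule inj_onI)
      fix u v assume "u \<in> f ` X" "v \<in> f ` X"
        and eq: "nonadjacent (f ` X \<union> f ` H) ((`) f ` B) u = nonadjacent (f ` X \<union> f ` H) ((`) f ` B) v"
      then obtain x y where xy: "x \<in> X" "y \<in> X" "u = f x" "v = f y" by blast
      have "f ` nonadjacent (X \<union> H) B x = f ` nonadjacent (X \<union> H) B y"
        using eq xy by (simp add: nb)
      then have "nonadjacent (X \<union> H) B x = nonadjacent (X \<union> H) B y"
        using inj_on_image_eq_iff[OF f] nonadjacent_subset xy by (simp add: le_supI1)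
      then show "u = v" using inj_onD[OF inj_nonadjacent] xy by blast
    qed
  qed
qed

definition admissible :: "nat \<Rightarrow> bool" where
  "admissible n \<longleftrightarrow> (\<exists>B. pent_with_hole {..<3 * n} {3 * n..<3 * n + 8} B)"

lemma pent_with_hole_transfer:
  assumes P: "pent_with_hole X H B" and H: "card H = 8"
    and X': "finite X'" "card X' = card X" and H': "card H' = 8" and disj: "X' \<inter> H' = {}"
  shows "\<exists>B'. pent_with_hole X' H' B'"
proof -
  interpret pent_with_hole X H B by (rule P)
  have fin: "finite H" "finite H'" using H H' card.infinite by fastforce+
  obtain f where f: "bij_betw f X X'" using finite_same_card_bij[OF finite_X X'(1)] X'(2) by auto
  obtain g where g: "bij_betw g H H'" using finite_same_card_bij[OF fin] H H' by auto
  define h where "h x = (if x \<in> X then f x else g x)" for x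
  have "bij_betw h X X'" using f by (subst bij_betw_cong[where g = f]) (auto simp: h_def)
  moreover have "bij_betw h H H'"
    using g disjoint by (subst bij_betw_cong[where g = g]) (auto simp: h_def)
  ultimately have "inj_on h (X \<union> H)" "h ` X = X'" "h ` H = H'"
    using bij_betw_combine[of h X X' H H'] disj by (auto simp: bij_betw_def)
  then show ?thesis using pent_with_hole_image[OF P, of h] by auto
qed

lemma admissibleI:
  assumes "pent_with_hole X H B" "card X = 3 * n" "card H = 8"
  shows "admissible n"
  unfolding admissible_def by (rule pent_with_hole_transfer[OF assms(1,3)]) (auto simp: assms)

lemma admissibleE:
  assumes "admissible n" "finite X" "card X = 3 * n" "card H = 8" "X \<inter> H = {}"
  obtains B where "pent_with_hole X H B"
proof -
  obtain B where "pent_with_hole {..<3 * n} {3 * n..<3 * n + 8} B"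
    using assms(1) unfolding admissible_def by blast
  from pent_with_hole_transfer[OF this, of X H] show thesis using that assms by auto
qed

text \<open>This is \<open>PENT(4, 1)\<close>: two disjoint lines and nothing else. As the value of
  \<open>m\<close> it stands for deleting a whole group of the transversal design.\<close>

lemma admissible_0: "admissible 0"
  by (rule admissibleI[of "{}" "{..<8::nat}" "{}"]) (auto intro!: pent_with_hole.intro)

section \<open>Gluing along a common hole\<close>

text \<open>The blocks of \<open>A\<close> join points of different groups \<open>X i\<close>, so
  every noncollinear pair stays within one group, and the opposite line of a point is the one from
  its own part.\<close>

lemma pent_with_hole_glue:
  assumes fin: "finite I"
    and parts: "\<And>i. i \<in> I \<Longrightarrow> pent_with_hole (X i) H (B i)"
    and disj: "\<And>i j. \<lbrakk>i \<in> I; j \<in> I; i \<noteq> j\<rbrakk> \<Longrightarrow> X i \<inter> X j = {}"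
    and A_subset: "\<And>b. b \<in> A \<Longrightarrow> b \<subseteq> (\<Union>i\<in>I. X i)"
    and A_card: "\<And>b. b \<in> A \<Longrightarrow> card b = 4"
    and A_group: "\<And>b i x y. \<lbrakk>b \<in> A; i \<in> I; x \<in> b; y \<in> b; x \<in> X i; y \<in> X i\<rbrakk> \<Longrightarrow> x = y"
    and A_unique: "\<And>b c x y. \<lbrakk>b \<in> A; c \<in> A; x \<in> b; y \<in> b; x \<in> c; y \<in> c; x \<noteq> y\<rbrakk> \<Longrightarrow> b = c"
    and A_exists: "\<And>i j x y. \<lbrakk>i \<in> I; j \<in> I; i \<noteq> j; x \<in> X i; y \<in> X j\<rbrakk> \<Longrightarrow> \<exists>b\<in>A. x \<in> b \<and> y \<in> b"
  shows "pent_with_hole (\<Union>i\<in>I. X i) H (A \<union> (\<Union>i\<in>I. B i))"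
proof -
  let ?X = "\<Union>i\<in>I. X i" and ?B = "A \<union> (\<Union>i\<in>I. B i)"
  have XH: "x \<notin> H" if "i \<in> I" "x \<in> X i" for i x
    using pent_with_hole.disjoint[OF parts[OF that(1)]] that(2) by blast
  have B_subset: "b \<subseteq> X i \<union> H" if "i \<in> I" "b \<in> B i" for i b
    using pent_with_hole.block_subset[OF parts] that .
  have same: "i = j" if "i \<in> I" "j \<in> I" "x \<in> X i" "x \<in> X j" for i j x
    using disj[OF that(1,2)] that(3,4) by blast
  \<comment> \<open>A block of \<open>A\<close> avoids the hole, so it meets a block of part
    \<open>i\<close> only inside \<open>X i\<close>, where it has at most one point.\<close>
  have AB: "x = y" if "b \<in> A" "i \<in> I" "c \<in> B i" "x \<in> b" "y \<in> b" "x \<in> c" "y \<in> c" for b c i x y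
  proof -
    have "x \<in> X i" "y \<in> X i"
      using that A_subset[OF that(1)] B_subset[OF that(2,3)] XH by blast+
    then show ?thesis using A_group that by blast
  qed
  \<comment> \<open>Blocks of different parts can meet only in the hole, where each has at most one
    point.\<close>
  have BB: "b = c" if "i \<in> I" "b \<in> B i" "j \<in> I" "c \<in> B j" "x \<in> b" "y \<in> b" "x \<in> c" "y \<in> c" "x \<noteq> y"
    for b c i j x y
  proof (cases "i = j")
    case True
    then show ?thesis using pent_with_hole.block_unique[OF parts[OF that(1)]] that by blast
  next
    case False
    then have "X i \<inter> X j = {}" using disj that by blast
    then have "x \<in> H" "y \<in> H"
      using that B_subset[OF that(1,2)] B_subset[OF that(3,4)] by blast+
    then show ?thesis using pent_with_hole.block_hole[OF parts[OF that(1)]] that by blast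
  qed
  have nb: "nonadjacent (?X \<union> H) ?B x = nonadjacent (X i \<union> H) (B i) x" (is "?L = ?R")
    if i: "i \<in> I" and x: "x \<in> X i" for i x
  proof (rule set_eqI)
    fix y
    show "y \<in> ?L \<longleftrightarrow> y \<in> ?R"
    proof
      assume y: "y \<in> ?L"
      then have "y \<in> X i \<union> H"
      proof -
        have False if j: "j \<in> I" "y \<in> X j" "j \<noteq> i" for j
        proof -
          obtain b where "b \<in> A" "x \<in> b" "y \<in> b"
            using A_exists[OF i j(1) _ x j(2)] j(3) by blast
          then show False using y by (simp add: nonadjacent_def)
        qed
        then show ?thesis using y by (auto simp: nonadjacent_def)
      qed
      then show "y \<in> ?R" using y i by (auto simp: nonadjacent_def)
    next
      assume y: "y \<in> ?R"
      have "y \<notin> b" if "b \<in> A" "x \<in> b" for b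
      proof
        assume "y \<in> b"
        then have "y \<in> X i"
          using y A_subset[OF that(1)] XH by (auto simp: nonadjacent_def)
        then have "x = y" by (rule A_group[OF that(1) i that(2) \<open>y \<in> b\<close> x])
        then show False using y by (simp add: nonadjacent_def)
      qed
      moreover have "y \<notin> b" if "j \<in> I" "b \<in> B j" "x \<in> b" for b j
      proof -
        have "j = i" using that B_subset[OF that(1,2)] x i same XH by blast
        then show ?thesis using that y by (auto simp: nonadjacent_def)
      qed
      ultimately show "y \<in> ?L" using y i by (auto simp: nonadjacent_def)
    qed
  qed
  show ?thesis
  proof (rule pent_with_hole.intro)
    show "finite ?X" using fin pent_with_hole.finite_X[OF parts] by blast
    show "?X \<inter> H = {}" using XH by blast
    show "b \<subseteq> ?X \<union> H" if "b \<in> ?B" for b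
      using that A_subset B_subset by blast
    show "card b = 4" if "b \<in> ?B" for b
      using that A_card pent_with_hole.card_block[OF parts] by blast
    show "x = y" if "b \<in> ?B" "x \<in> b" "y \<in> b" "x \<in> H" "y \<in> H" for b x y
      using that A_subset XH pent_with_hole.block_hole[OF parts] by blast
    show "b = c" if "b \<in> ?B" "c \<in> ?B" "x \<in> b" "y \<in> b" "x \<in> c" "y \<in> c" "x \<noteq> y" for b c x y
      using that(1,2)
    proof (elim UnE UN_E)
      assume "b \<in> A" "c \<in> A"
      then show ?thesis using A_unique that(3-) by blast
    next
      fix i assume "b \<in> A" "i \<in> I" "c \<in> B i"
      then show ?thesis using AB that(3-) by blast
    next
      fix i assume "c \<in> A" "i \<in> I" "b \<in> B i"
      then show ?thesis using AB that(3-) by blast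
    next
      fix i j assume "i \<in> I" "b \<in> B i" "j \<in> I" "c \<in> B j"
      then show ?thesis using BB that(3-) by blast
    qed
    show "nonadjacent (?X \<union> H) ?B x \<in> ?B" "nonadjacent (?X \<union> H) ?B x \<subseteq> ?X" if x: "x \<in> ?X" for x
    proof -
      obtain i where i: "i \<in> I" "x \<in> X i" using x by blast
      show "nonadjacent (?X \<union> H) ?B x \<in> ?B"
        using pent_with_hole.nonadjacent_block[OF parts] i unfolding nb[OF i] by blast
      show "nonadjacent (?X \<union> H) ?B x \<subseteq> ?X"
        using pent_with_hole.nonadjacent_subset[OF parts] i unfolding nb[OF i] by blast
    qed
    show "inj_on (nonadjacent (?X \<union> H) ?B) ?X"
    proof (rule inj_onI)
      fix x y assume "x \<in> ?X" "y \<in> ?X"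
        and eq: "nonadjacent (?X \<union> H) ?B x = nonadjacent (?X \<union> H) ?B y"
      then obtain i j where i: "i \<in> I" "x \<in> X i" and j: "j \<in> I" "y \<in> X j" by blast
      have eq': "nonadjacent (X i \<union> H) (B i) x = nonadjacent (X j \<union> H) (B j) y"
        using eq by (simp only: nb[OF i] nb[OF j])
      \<comment> \<open>Opposite lines are nonempty and stay in their own group, so equal ones come
        from the same part.\<close>
      have "nonadjacent (X i \<union> H) (B i) x \<noteq> {}"
        using pent_with_hole.nonadjacent_block[OF parts[OF i(1)] i(2)]
          pent_with_hole.card_block[OF parts[OF i(1)]] by fastforce
      moreover have "nonadjacent (X i \<union> H) (B i) x \<subseteq> X i" "nonadjacent (X j \<union> H) (B j) y \<subseteq> X j"
        using pent_with_hole.nonadjacent_subset[OF parts] i j by blast+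
      ultimately have "i = j" using eq' disj[OF i(1) j(1)] by auto
      then show "x = y"
        using inj_onD[OF pent_with_hole.inj_nonadjacent[OF parts[OF i(1)]]] eq' i j by blast
    qed
  qed
qed

section \<open>Filling the hole with an opposite line pair\<close>

text \<open>Removing \<open>x\<close> from the lines through it partitions its collinear points into
  triples; \<open>x\<close> and the four points of \<open>opp x\<close> make up the remaining 5.
  Regularity therefore follows from the number of points alone.\<close>

lemma (in partial_linear_space) card_lines_through_eq:
  assumes x: "x \<in> points" and card4: "\<And>L. L \<in> lines \<Longrightarrow> card L = 4" and opp4: "card (opp x) = 4"
  shows "3 * card {L \<in> lines. x \<in> L} + 5 = card points"
proof -
  let ?T = "{L \<in> lines. x \<in> L}"
  let ?C = "(\<lambda>L. L - {x}) ` ?T"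
  have "lines \<subseteq> Pow points" using lines_subset by blast
  then have fin: "finite ?T" using finite_points by (auto intro: finite_subset)
  have UC: "\<Union>?C = points - insert x (opp x)"
    using lines_subset x by (auto simp: opp_def collinear_points_def)
  have "3 * card ?C = card (\<Union>?C)"
  proof (rule card_partition)
    show "finite ?C" using fin by simp
    show "finite (\<Union>?C)" unfolding UC using finite_points by simp
    show "card c = 3" if "c \<in> ?C" for c using that card4 by auto
    show "c \<inter> d = {}" if "c \<in> ?C" "d \<in> ?C" "c \<noteq> d" for c d
      using that line_unique by blast
  qed
  moreover have "card ?C = card ?T"
    by (rule card_image) (auto simp: inj_on_def)
  moreover have "insert x (opp x) \<subseteq> points" "card (insert x (opp x)) = 5"
    using x opp4 finite_points by (auto simp: opp_def card_insert_if)
  then have "card (points - insert x (opp x)) = card points - 5" "5 \<le> card points"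
    using finite_points card_mono by (metis card_Diff_subset finite_subset, metis)
  ultimately show ?thesis using UC by simp
qed

lemma admissible_imp_pentagonal_geometry:
  assumes "admissible n"
  shows "\<exists>(points :: nat set) lines. pentagonal_geometry points lines 4 (n + 1) \<and>
           card (partial_linear_space.opposite_line_pairs points lines) = 1"
proof -
  define X where "X = {..<3 * n}"
  define P where "P = {3 * n..<3 * n + 4}"
  define Q where "Q = {3 * n + 4..<3 * n + 8}"
  have H: "{3 * n..<3 * n + 8} = P \<union> Q" by (auto simp: P_def Q_def)
  obtain B where "pent_with_hole X (P \<union> Q) B"
    using assms unfolding admissible_def X_def H by blast
  then interpret D: pent_with_hole X "P \<union> Q" B .
  have card_PQ: "card P = 4" "card Q = 4" and PQ: "P \<inter> Q = {}" by (auto simp: P_def Q_def)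
  have XPQ: "X \<inter> P = {}" "X \<inter> Q = {}" using D.disjoint by blast+
  have ne: "P \<noteq> {}" "Q \<noteq> {}" by (auto simp: P_def Q_def)
  define V where "V = X \<union> (P \<union> Q)"
  define L where "L = insert P (insert Q B)"
  have cardL: "card l = 4" if "l \<in> L" for l
    using that card_PQ D.card_block by (auto simp: L_def)
  interpret G: partial_linear_space V L
  proof
    show "finite V" using D.finite_X by (auto simp: V_def P_def Q_def)
    show "V \<noteq> {}" using ne by (auto simp: V_def)
    show "l \<subseteq> V" if "l \<in> L" for l using that D.block_subset by (auto simp: L_def V_def)
    show "2 \<le> card l" if "l \<in> L" for l using cardL[OF that] by simp
    show "l = m" if "x \<noteq> y" "l \<in> L" "m \<in> L" "x \<in> l" "y \<in> l" "x \<in> m" "y \<in> m" for x y l m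
      using that PQ D.block_unique[of l m x y] D.block_hole[of l x y] D.block_hole[of m x y]
      by (auto simp: L_def)
  qed
  have oppX: "G.opp x = nonadjacent (X \<union> (P \<union> Q)) B x" if "x \<in> X" for x
  proof -
    have "x \<notin> P" "x \<notin> Q" using that XPQ by blast+
    then show ?thesis
      unfolding G.opp_def nonadjacent_def G.collinear_points_def unfolding V_def L_def by blast
  qed
  have XH: "G.collinear_points x y" if "y \<in> X" "x \<in> P \<union> Q" for x y
  proof -
    have "x \<notin> G.opp y" "x \<noteq> y"
      using D.nonadjacent_subset[OF that(1)] oppX[OF that(1)] that XPQ by auto
    then show ?thesis using that unfolding G.opp_def G.collinear_points_def unfolding V_def by blast
  qed
  have notPQ: "\<not> G.collinear_points x y" if "x \<in> P" "y \<in> Q" for x y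
  proof
    assume "G.collinear_points x y"
    then obtain l where "l \<in> L" "x \<in> l" "y \<in> l" "x \<noteq> y"
      unfolding G.collinear_points_def by blast
    then show False using that PQ D.block_hole[of l x y] by (auto simp: L_def)
  qed
  have sym: "G.collinear_points x y \<longleftrightarrow> G.collinear_points y x" for x y
    unfolding G.collinear_points_def by blast
  have inP: "G.collinear_points x y" if "x \<in> P" "y \<in> P" "x \<noteq> y" for x y
    using that unfolding G.collinear_points_def unfolding L_def by blast
  have inQ: "G.collinear_points x y" if "x \<in> Q" "y \<in> Q" "x \<noteq> y" for x y
    using that unfolding G.collinear_points_def unfolding L_def by blast
  have oppP: "G.opp x = Q" if "x \<in> P" for x
    using that PQ XH[of _ x] notPQ[of x] inP[of x] unfolding G.opp_def unfolding V_def by blast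
  have oppQ: "G.opp x = P" if "x \<in> Q" for x
    using that PQ XH[of _ x] notPQ[of _ x] inQ[of x] sym unfolding G.opp_def unfolding V_def by blast
  have opp: "G.opp x \<in> L" if "x \<in> V" for x
    using that oppP oppQ oppX D.nonadjacent_block by (auto simp: V_def L_def)
  have "card V = 3 * n + 8"
  proof -
    have "V = {..<3 * n + 8}" by (auto simp: V_def X_def P_def Q_def)
    then show ?thesis by simp
  qed
  then have lines_through: "card {l \<in> L. x \<in> l} = n + 1" if "x \<in> V" for x
    using G.card_lines_through_eq[OF that cardL] cardL[OF opp[OF that]] by simp
  have "pentagonal_geometry V L 4 (n + 1)"
    by unfold_locales (use cardL lines_through opp in auto)
  moreover have "G.opposite_line_pairs = {{P, Q}}"
  proof -
    \<comment> \<open>A block has at most one hole point, so at least two of its points lie in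
      \<open>X\<close>; they would share the opposite line \<open>m\<close>, against
      injectivity.\<close>
    have notB: "l \<notin> B" if lm: "\<forall>x\<in>l. G.opp x = m" for l m
    proof
      assume l: "l \<in> B"
      have "\<exists>x y. x \<in> l \<inter> X \<and> y \<in> l \<inter> X \<and> x \<noteq> y"
      proof -
        have fin: "finite l" using D.card_block[OF l] card.infinite by fastforce
        have "card (l \<inter> (P \<union> Q)) \<le> 1"
          using D.block_hole[OF l] fin by (auto simp: card_le_Suc0_iff_eq)
        moreover have "card l = card (l \<inter> X) + card (l \<inter> (P \<union> Q))"
          using D.block_subset[OF l] D.disjoint fin
          by (subst card_Un_disjoint[symmetric]) (auto intro: arg_cong[where f = card])
        ultimately have "\<not> card (l \<inter> X) \<le> Suc 0" using D.card_block[OF l] by simp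
        then show ?thesis using fin by (auto simp: card_le_Suc0_iff_eq)
      qed
      then obtain x y where xy: "x \<in> l" "y \<in> l" "x \<in> X" "y \<in> X" "x \<noteq> y" by blast
      then have "nonadjacent (X \<union> (P \<union> Q)) B x = nonadjacent (X \<union> (P \<union> Q)) B y"
        using lm oppX by metis
      then show False using inj_onD[OF D.inj_nonadjacent] xy by blast
    qed
    have "{l, m} = {P, Q}"
      if "l \<in> L" "\<forall>x\<in>l. G.opp x = m" for l m
    proof -
      have "l = P \<or> l = Q" using that notB by (auto simp: L_def)
      then show ?thesis
      proof
        assume "l = P"
        then have "m = Q" using that(2) oppP ne by auto
        with \<open>l = P\<close> show ?thesis by simp
      next
        assume "l = Q"
        then have "m = P" using that(2) oppQ ne by auto
        with \<open>l = Q\<close> show ?thesis by (simp add: insert_commute)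
      qed
    qed
    moreover have "{P, Q} \<in> G.opposite_line_pairs"
    proof -
      have "P \<in> L" "Q \<in> L" by (auto simp: L_def)
      moreover have "\<forall>x\<in>P. G.opp x = Q" "\<forall>x\<in>Q. G.opp x = P" using oppP oppQ by simp_all
      ultimately show ?thesis
        unfolding G.opposite_line_pairs_def using PQ
        by (intro CollectI exI[of _ P] exI[of _ Q] conjI refl)
    qed
    moreover have "p = {P, Q}" if p: "p \<in> G.opposite_line_pairs" for p
    proof -
      obtain l m where "p = {l, m}" "l \<in> L" "\<forall>x\<in>l. G.opp x = m"
        using p unfolding G.opposite_line_pairs_def by blast
      then show ?thesis using calculation(1) by simp
    qed
    ultimately show ?thesis by blast
  qed
  then have "card G.opposite_line_pairs = 1" by simp
  ultimately show ?thesis by blast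
qed

section \<open>Quintupling\<close>

text \<open>A group divisible design of type \<open>3^k\<close> with block size four, the ingredient
  that replaces a block of size \<open>k\<close> when every point gets weight three. Lists with
  bounded quantifiers let simplification decide the conditions.\<close>

definition gdd3 :: "nat \<Rightarrow> (nat \<times> nat) list list \<Rightarrow> bool" where
  "gdd3 k G \<longleftrightarrow>
     (\<forall>g\<in>set G. length g = 4 \<and> distinct (map fst g) \<and> (\<forall>p\<in>set g. fst p < k \<and> snd p < 3)) \<and>
     (\<forall>g\<in>set G. \<forall>h\<in>set G. \<forall>p\<in>set g. \<forall>q\<in>set g. p \<in> set h \<longrightarrow> q \<in> set h \<longrightarrow> p \<noteq> q \<longrightarrow> g = h) \<and>
     (\<forall>i\<in>set [0..<k]. \<forall>j\<in>set [0..<k]. \<forall>a\<in>set [0..<3]. \<forall>c\<in>set [0..<3].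
        i \<noteq> j \<longrightarrow> (\<exists>g\<in>set G. (i, a) \<in> set g \<and> (j, c) \<in> set g))"

text \<open>The first design is the dual of \<open>AG(2, 3)\<close>, the second one is \<open>AG(2, 4)\<close> with a point removed.\<close>
definition gdd3_4 :: "(nat \<times> nat) list list" where
  "gdd3_4 = [[(0, c), (1, (c + d) mod 3), (2, (c + 2 * d) mod 3), (3, d)]. c \<leftarrow> [0..<3], d \<leftarrow> [0..<3]]"

definition gdd3_5 :: "(nat \<times> nat) list list" where
  "gdd3_5 =
    [[(0, 0), (1, 0), (3, 1), (4, 2)], [(0, 0), (1, 1), (2, 2), (3, 0)], [(0, 0), (1, 2), (2, 1), (4, 0)],
     [(0, 0), (2, 0), (3, 2), (4, 1)], [(0, 1), (1, 0), (2, 2), (4, 1)], [(0, 1), (1, 1), (3, 2), (4, 0)],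
     [(0, 1), (1, 2), (2, 0), (3, 1)], [(0, 1), (2, 1), (3, 0), (4, 2)], [(0, 2), (1, 0), (2, 1), (3, 2)],
     [(0, 2), (1, 1), (2, 0), (4, 2)], [(0, 2), (1, 2), (3, 0), (4, 1)], [(0, 2), (2, 2), (3, 1), (4, 0)],
     [(1, 0), (2, 0), (3, 0), (4, 0)], [(1, 1), (2, 1), (3, 1), (4, 1)], [(1, 2), (2, 2), (3, 2), (4, 2)]]"

lemma gdd3_4: "gdd3 4 gdd3_4"
  unfolding gdd3_def gdd3_4_def by (simp add: upt_rec)

lemma gdd3_5: "gdd3 5 gdd3_5"
  unfolding gdd3_def gdd3_5_def by (simp add: upt_rec)

lemma gdd3D:
  assumes "gdd3 k G"
  shows "g \<in> set G \<Longrightarrow> length g = 4"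
    and "g \<in> set G \<Longrightarrow> distinct (map fst g)"
    and "g \<in> set G \<Longrightarrow> p \<in> set g \<Longrightarrow> fst p < k \<and> snd p < 3"
    and "\<lbrakk>g \<in> set G; h \<in> set G; p \<in> set g; q \<in> set g; p \<in> set h; q \<in> set h; p \<noteq> q\<rbrakk> \<Longrightarrow> g = h"
    and "\<lbrakk>i < k; j < k; i \<noteq> j; a < 3; c < 3\<rbrakk> \<Longrightarrow> \<exists>g\<in>set G. (i, a) \<in> set g \<and> (j, c) \<in> set g"
proof -
  note D = assms[unfolded gdd3_def]
  show "g \<in> set G \<Longrightarrow> length g = 4" "g \<in> set G \<Longrightarrow> distinct (map fst g)"
    "g \<in> set G \<Longrightarrow> p \<in> set g \<Longrightarrow> fst p < k \<and> snd p < 3"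
    using D[THEN conjunct1] by blast+
  show "g = h" if "g \<in> set G" "h \<in> set G" "p \<in> set g" "q \<in> set g" "p \<in> set h" "q \<in> set h" "p \<noteq> q"
    using D[THEN conjunct2, THEN conjunct1] that by blast
  show "\<exists>g\<in>set G. (i, a) \<in> set g \<and> (j, c) \<in> set g" if "i < k" "j < k" "i \<noteq> j" "a < 3" "c < 3"
    using D[THEN conjunct2, THEN conjunct2] that by simp
qed

text \<open>The block with parameters \<open>b, s\<close> is the line \<open>y = b + s * i\<close> over \<open>\<int>/n\<close> restricted to \<open>i < 4\<close>,
  extended by its slope \<open>s\<close> in group \<open>4\<close>. Two points determine it because the differences of
  \<open>0, 1, 2, 3\<close> are units modulo \<open>n\<close>.\<close>
definition td_point :: "nat \<Rightarrow> nat \<Rightarrow> nat \<Rightarrow> nat \<Rightarrow> nat" where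
  "td_point n b s i = (if i < 4 then (b + i * s) mod n else s)"

lemma td_point_less: "b < n \<Longrightarrow> s < n \<Longrightarrow> td_point n b s i < n"
  by (simp add: td_point_def)

lemma td_point_inject:
  assumes n: "coprime n 6" and ij: "i < j" "j < 5"
    and lt: "b < n" "s < n" "b' < n" "s' < n"
    and i: "td_point n b s i = td_point n b' s' i" and j: "td_point n b s j = td_point n b' s' j"
  shows "b = b' \<and> s = s'"
proof -
  have ci: "[b + i * s = b' + i * s'] (mod n)"
    using i ij by (simp add: td_point_def cong_def)
  have s: "s = s'"
  proof (cases "j < 4")
    case True
    have "[b + j * s = b' + j * s'] (mod n)"
      using j True by (simp add: td_point_def cong_def)
    moreover have "b + j * s = (b + i * s) + (j - i) * s" "b' + j * s' = (b' + i * s') + (j - i) * s'"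
      using ij(1) by (simp_all add: add.assoc flip: add_mult_distrib)
    ultimately have "[(b + i * s) + (j - i) * s = (b' + i * s') + (j - i) * s'] (mod n)" by simp
    then have "[(b + i * s) + (j - i) * s = (b + i * s) + (j - i) * s'] (mod n)"
      using cong_add[OF cong_sym[OF ci] cong_refl] cong_trans by metis
    then have "[(j - i) * s = (j - i) * s'] (mod n)" by (simp add: cong_add_lcancel_nat)
    moreover have "coprime (j - i) n"
    proof -
      have "j - i = 1 \<or> j - i = 2 \<or> j - i = 3" using ij(1) True by linarith
      then have "j - i dvd 6" by auto
      then show ?thesis using n by (meson coprime_commute coprime_divisors dvd_refl)
    qed
    ultimately have "[s = s'] (mod n)" using cong_mult_lcancel_nat by blast
    then show ?thesis using lt by (simp add: cong_def)
  next
    case False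
    then show ?thesis using j by (simp add: td_point_def)
  qed
  then have "[b = b'] (mod n)" using ci by (simp add: cong_add_rcancel_nat)
  then show ?thesis using s lt by (simp add: cong_def)
qed

lemma td_point_inject':
  assumes "coprime n 6" "i \<noteq> j" "i < 5" "j < 5" "b < n" "s < n" "b' < n" "s' < n"
    and "td_point n b s i = td_point n b' s' i" "td_point n b s j = td_point n b' s' j"
  shows "b = b' \<and> s = s'"
  using td_point_inject[of n i j b s b' s'] td_point_inject[of n j i b s b' s'] assms
  by (cases i j rule: linorder_cases) simp_all

text \<open>For fixed groups \<open>i\<close> and \<open>j\<close>, the map from parameters
  \<open>(b, s)\<close> to the pair of points is an injective map of a finite set into itself, hence
  onto.\<close>

lemma td_point_exists:
  assumes "coprime n 6" "i \<noteq> j" "i < 5" "j < 5" "x < n" "y < n"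
  obtains b s where "b < n" "s < n" "td_point n b s i = x" "td_point n b s j = y"
proof -
  let ?S = "{..<n} \<times> {..<n}" and ?f = "\<lambda>(b, s). (td_point n b s i, td_point n b s j)"
  have "inj_on ?f ?S"
    using td_point_inject'[OF assms(1-4)] by (auto simp: inj_on_def)
  moreover have "?f ` ?S \<subseteq> ?S" using td_point_less by auto
  ultimately have "?f ` ?S = ?S" by (intro endo_inj_surj) auto
  then have "(x, y) \<in> ?f ` ?S" using assms by auto
  then show thesis using that by auto
qed

text \<open>Wilson's fundamental construction: each block of the truncated transversal design is
  replaced by a copy of a group divisible design on its weighted points, and the groups are then
  filled by \<open>pent_with_hole_glue\<close>.\<close>

lemma admissible_quintuple:
  assumes n: "admissible n" and m: "admissible m" and mn: "m \<le> n" and cop: "coprime n 6"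
  shows "admissible (4 * n + m)"
proof -
  define w where "w i = (if i < 4 then n else m)" for i :: nat
  define X where "X i = {i} \<times> {..<w i} \<times> {..<3::nat}" for i :: nat
  define H where "H = {5::nat} \<times> {..<8::nat} \<times> {0::nat}"
  \<comment> \<open>The point of a line in group 4 is its slope \<open>s\<close>, which survives the
    truncation exactly if \<open>s < m\<close>; otherwise the block has only four points
    left.\<close>
  define G where "G s = (if s < m then gdd3_5 else gdd3_4)" for s
  define blk where "blk b s g = (\<lambda>p. (fst p, td_point n b s (fst p), snd p)) ` set g" for b s and g :: "(nat \<times> nat) list"
  define A where "A = {blk b s g | b s g. b < n \<and> s < n \<and> g \<in> set (G s)}"
  have Gg: "gdd3 (if s < m then 5 else 4) (G s)" for s
    using gdd3_4 gdd3_5 by (simp add: G_def)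
  have mem: "(i, x, a) \<in> blk b s g \<longleftrightarrow> (i, a) \<in> set g \<and> x = td_point n b s i" for i x a b s g
    unfolding blk_def image_iff by (auto intro: bexI[of _ "(i, a)"])
  have snd_eq: "a = d" if "g \<in> set (G s)" "(i, a) \<in> set g" "(i, d) \<in> set g" for g s i a d
    using eq_key_imp_eq_value[OF gdd3D(2)[OF Gg that(1)] that(2,3)] .
  have lt5: "i < 5" if "g \<in> set (G s)" "(i, a) \<in> set g" for i a g s
    using gdd3D(3)[OF Gg that] by (auto split: if_splits)
  have parts: "\<exists>B. pent_with_hole (X i) H B" if "i \<in> {..<5}" for i
  proof -
    have "admissible (w i)" using n m by (simp add: w_def)
    moreover have "finite (X i)" "card (X i) = 3 * w i" "card H = 8" "X i \<inter> H = {}"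
      using that by (auto simp: X_def H_def card_cartesian_product)
    ultimately show ?thesis using admissibleE by blast
  qed
  then obtain B where B: "\<And>i. i \<in> {..<5} \<Longrightarrow> pent_with_hole (X i) H (B i)"
    using bchoice[of "{..<5}" "\<lambda>i B. pent_with_hole (X i) H B"] by blast
  have "pent_with_hole (\<Union>i\<in>{..<5}. X i) H (A \<union> (\<Union>i\<in>{..<5}. B i))"
  proof (rule pent_with_hole_glue[OF _ B])
    show "X i \<inter> X j = {}" if "i \<noteq> j" for i j using that by (auto simp: X_def)
    show "b \<subseteq> (\<Union>i\<in>{..<5}. X i)" if "b \<in> A" for b
    proof
      fix p assume p: "p \<in> b"
      obtain c s g where c: "b = blk c s g" "c < n" "s < n" "g \<in> set (G s)"
        using \<open>b \<in> A\<close> by (auto simp: A_def)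
      obtain i x a where ixa: "p = (i, x, a)" by (cases p)
      then have ia: "(i, a) \<in> set g" "x = td_point n c s i" using p c mem by auto
      have "i < (if s < m then 5 else 4)" "a < 3" using gdd3D(3)[OF Gg c(4) ia(1)] by auto
      then have "i < 5" "a < 3" "x < w i"
        using c ia(2) td_point_less[of c n s i] by (auto simp: w_def td_point_def split: if_splits)
      then show "p \<in> (\<Union>i\<in>{..<5}. X i)" using ixa by (auto simp: X_def)
    qed
    show "card b = 4" if "b \<in> A" for b
    proof -
      obtain c s g where c: "b = blk c s g" "g \<in> set (G s)" using \<open>b \<in> A\<close> by (auto simp: A_def)
      have "card b = card (set g)"
        unfolding c blk_def by (rule card_image) (auto simp: inj_on_def prod_eq_iff)
      also have "\<dots> = 4"
        using gdd3D(1,2)[OF Gg c(2)] distinct_card[of g] by (simp add: distinct_map)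
      finally show ?thesis .
    qed
    show "x = y" if "b \<in> A" "x \<in> b" "y \<in> b" "x \<in> X i" "y \<in> X i" for b i x y
    proof -
      obtain c s g where c: "b = blk c s g" "g \<in> set (G s)" using \<open>b \<in> A\<close> by (auto simp: A_def)
      obtain u a v d where "x = (i, u, a)" "y = (i, v, d)"
        using \<open>x \<in> X i\<close> \<open>y \<in> X i\<close> by (auto simp: X_def)
      moreover from this have "(i, a) \<in> set g" "(i, d) \<in> set g" "u = td_point n c s i" "v = td_point n c s i"
        using \<open>x \<in> b\<close> \<open>y \<in> b\<close> c mem by auto
      ultimately show ?thesis using snd_eq[OF c(2)] by simp
    qed
    show "b = c" if "b \<in> A" "c \<in> A" "x \<in> b" "y \<in> b" "x \<in> c" "y \<in> c" "x \<noteq> y" for b c x y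
    proof -
      obtain t s g where b: "b = blk t s g" "t < n" "s < n" "g \<in> set (G s)"
        using \<open>b \<in> A\<close> by (auto simp: A_def)
      obtain t' s' g' where c: "c = blk t' s' g'" "t' < n" "s' < n" "g' \<in> set (G s')"
        using \<open>c \<in> A\<close> by (auto simp: A_def)
      obtain i u a where x: "x = (i, u, a)" by (cases x)
      obtain j v d where y: "y = (j, v, d)" by (cases y)
      have g: "(i, a) \<in> set g" "(j, d) \<in> set g" "u = td_point n t s i" "v = td_point n t s j"
        using that(3,4) unfolding b x y mem by simp_all
      have g': "(i, a) \<in> set g'" "(j, d) \<in> set g'" "u = td_point n t' s' i" "v = td_point n t' s' j"
        using that(5,6) unfolding c x y mem by simp_all
      have "i \<noteq> j"
      proof
        assume "i = j"
        then have "a = d" using snd_eq[OF b(4)] g(1,2) by simp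
        then show False using \<open>x \<noteq> y\<close> \<open>i = j\<close> g x y by simp
      qed
      then have ts: "t = t' \<and> s = s'"
        using td_point_inject'[OF cop _ lt5[OF b(4) g(1)] lt5[OF b(4) g(2)] b(2,3) c(2,3)] g g' by simp
      then have "g = g'"
        using gdd3D(4)[OF Gg b(4), of g' "(i, a)" "(j, d)"] c(4) g g' \<open>i \<noteq> j\<close> by simp
      then show ?thesis using b c ts by simp
    qed
    show "\<exists>b\<in>A. x \<in> b \<and> y \<in> b"
      if ij: "i \<in> {..<5}" "j \<in> {..<5}" "i \<noteq> j" and "x \<in> X i" "y \<in> X j" for i j x y
    proof -
      obtain u a where x: "x = (i, u, a)" "u < w i" "a < 3" using \<open>x \<in> X i\<close> by (auto simp: X_def)
      obtain v d where y: "y = (j, v, d)" "v < w j" "d < 3" using \<open>y \<in> X j\<close> by (auto simp: X_def)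
      have "u < n" "v < n" using x y mn by (auto simp: w_def split: if_splits)
      then obtain b s where bs: "b < n" "s < n" "td_point n b s i = u" "td_point n b s j = v"
        using td_point_exists[OF cop, of i j u v] ij by auto
      \<comment> \<open>If one of the two given points lies in group 4, its coordinate is the slope,
        so the slope is below \<open>m\<close> and the larger ingredient is in use.\<close>
      have "s < m \<or> (i < 4 \<and> j < 4)"
        using bs x y by (auto simp: td_point_def w_def split: if_splits)
      then have "i < (if s < m then 5 else 4)" "j < (if s < m then 5 else 4)" using ij by auto
      then obtain g where "g \<in> set (G s)" "(i, a) \<in> set g" "(j, d) \<in> set g"
        using gdd3D(5)[OF Gg, of i s j a d] ij x y by blast
      then have "blk b s g \<in> A" "x \<in> blk b s g" "y \<in> blk b s g"
        using bs x y mem by (auto simp: A_def)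
      then show ?thesis by blast
    qed
  qed simp
  moreover have "card (\<Union>i\<in>{..<5}. X i) = 3 * (4 * n + m)"
  proof -
    have "card (\<Union>i\<in>{..<5}. X i) = (\<Sum>i\<in>{..<5}. card (X i))"
      by (rule card_UN_disjoint) (auto simp: X_def)
    also have "\<dots> = (\<Sum>i<5. 3 * w i)" by (simp add: X_def card_cartesian_product mult.commute)
    also have "\<dots> = 3 * (4 * n + m)" by (simp add: w_def eval_nat_numeral)
    finally show ?thesis .
  qed
  moreover have "card H = 8" by (simp add: H_def card_cartesian_product)
  ultimately show ?thesis by (rule admissibleI)
qed

section \<open>Intervals of admissible numbers and the induction\<close>

definition admissible_run :: "nat \<Rightarrow> nat \<Rightarrow> bool" where
  "admissible_run a b \<longleftrightarrow> (\<forall>t\<in>{a..b}. t mod 4 = 0 \<or> t mod 4 = 3 \<longrightarrow> admissible t)"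

lemma admissible_run_subset:
  "admissible_run x y \<Longrightarrow> x \<le> a \<Longrightarrow> b \<le> y \<Longrightarrow> admissible_run a b"
  by (auto simp: admissible_run_def)

lemma coprime_6: "coprime n 6" if "n mod 12 = 7 \<or> n mod 12 = 11" for n :: nat
proof -
  have "n mod 6 = (n mod 12) mod 6" by (simp add: mod_mod_cancel)
  then have "n mod 6 = 1 \<or> n mod 6 = 5" using that by auto
  moreover have "coprime (5::nat) 6" using coprime_Suc_right_nat[of 5] by simp
  ultimately have "coprime (n mod 6) 6" by (metis coprime_1_left)
  then show ?thesis by (simp only: coprime_mod_left_iff)
qed

text \<open>The residues 7 and 11 leave gaps of length 4 and 8 alternately, so one has to go down by
  at most 7.\<close>

lemma ex_below_mod_12:
  assumes "q \<ge> 7"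
  obtains n :: nat where "n mod 12 = 7 \<or> n mod 12 = 11" "n \<le> q" "q < n + 8"
proof -
  define k r where "k = q div 12" and "r = q mod 12"
  have q: "q = 12 * k + r" "r < 12" by (simp_all add: k_def r_def)
  consider "r < 7" | "7 \<le> r" "r < 11" | "r = 11" using q(2) by linarith
  then show thesis
  proof cases
    case 1
    then obtain k' where "k = Suc k'" using q(1) assms by (cases k) auto
    then show thesis using that[of "12 * k' + 11"] q 1 by simp
  next
    case 2
    then show thesis using that[of "12 * k + 7"] q by simp
  next
    case 3
    then show thesis using that[of "12 * k + 11"] q by simp
  qed
qed

text \<open>For \<open>q = (t - a) div 4\<close> and a suitable \<open>n\<close> with
  \<open>n \<le> q \<le> n + 7\<close>, the remainder \<open>t - 4 * n\<close> lies between
  \<open>a\<close> and \<open>a + 28 + 3\<close>. A run \<open>a..b\<close> with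
  \<open>a + 31 \<le> b\<close> therefore bridges the gaps between consecutive
  \<open>n\<close>.\<close>

lemma admissible_run_step:
  assumes cd: "admissible_run c d" and ab: "admissible_run a b" and "b \<le> c" "c \<le> d"
    and c: "c mod 12 = 7 \<or> c mod 12 = 11" and d: "d mod 12 = 7 \<or> d mod 12 = 11"
    and long: "c = d \<or> a + 31 \<le> b"
  shows "admissible_run (4 * c + a) (4 * d + b)"
  unfolding admissible_run_def
proof (intro ballI impI)
  fix t assume t: "t \<in> {4 * c + a..4 * d + b}" and mod: "t mod 4 = 0 \<or> t mod 4 = 3"
  have "\<exists>n. c \<le> n \<and> n \<le> d \<and> (n mod 12 = 7 \<or> n mod 12 = 11) \<and> 4 * n + a \<le> t \<and> t \<le> 4 * n + b"
  proof (cases "4 * d + a \<le> t")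
    case True
    then show ?thesis using t d \<open>c \<le> d\<close> by auto
  next
    case False
    \<comment> \<open>Here \<open>4 * c + a \<le> t < 4 * d + a\<close>, which rules out
      \<open>c = d\<close>.\<close>
    then have long: "a + 31 \<le> b" using long t by auto
    define q where "q = (t - a) div 4"
    have q: "4 * q + a \<le> t" "t < 4 * q + a + 4" using t unfolding q_def by auto
    have "c \<le> q" "q < d" using t q False by auto
    moreover have "7 \<le> c" using c mod_less_eq_dividend[of c 12] by linarith
    ultimately obtain n where n: "n mod 12 = 7 \<or> n mod 12 = 11" "n \<le> q" "q < n + 8"
      using ex_below_mod_12[of q] by auto
    show ?thesis
    proof (cases "c \<le> n")
      case True
      then show ?thesis using n q long \<open>q < d\<close> by (intro exI[of _ n]) auto
    next
      \<comment> \<open>The number found dropped below \<open>c\<close>; as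
        \<open>n < c \<le> q < n + 8\<close>, the end point \<open>c\<close> itself is close enough
        to \<open>q\<close>.\<close>
      case False
      then show ?thesis using c n q t long \<open>c \<le> q\<close> \<open>c \<le> d\<close> by (intro exI[of _ c]) auto
    qed
  qed
  then obtain n where n: "c \<le> n" "n \<le> d" "n mod 12 = 7 \<or> n mod 12 = 11" "4 * n + a \<le> t" "t \<le> 4 * n + b"
    by blast
  have "n mod 4 = (n mod 12) mod 4" by (simp add: mod_mod_cancel)
  then have "n mod 4 = 3" using n(3) by auto
  then have n_adm: "admissible n" using cd n(1,2) unfolding admissible_run_def by auto
  have "(t - 4 * n) mod 4 = t mod 4"
    using n(4) by (metis add_leD1 le_add_diff_inverse mod_mult_self2 add.commute)
  moreover have "t - 4 * n \<in> {a..b}" using n(4,5) by auto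
  ultimately have "admissible (t - 4 * n)"
    using bspec[OF ab[unfolded admissible_run_def]] mod by metis
  then have "admissible (4 * n + (t - 4 * n))"
    using n n_adm \<open>b \<le> c\<close> by (intro admissible_quintuple coprime_6) auto
  then show "admissible t" using n(4) by simp
qed

lemma admissible_run_unbounded:
  assumes run: "admissible_run a (5 * a + 160)" and "a \<le> t" "t mod 4 = 0 \<or> t mod 4 = 3"
  shows "admissible t"
  using assms(2,3)
proof (induction t rule: less_induct)
  case (less t)
  show ?case
  proof (cases "t \<le> 5 * a + 160")
    case True
    then show ?thesis using run less.prems by (auto simp: admissible_run_def)
  next
    case False
    define q where "q = (t - a) div 4"
    have q: "4 * q + a \<le> t" "t < 4 * q + a + 4" using less.prems unfolding q_def by auto
    then have "7 \<le> q" using False by auto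
    then obtain n where n: "n mod 12 = 7 \<or> n mod 12 = 11" "n \<le> q" "q < n + 8"
      using ex_below_mod_12 by blast
    have "n mod 4 = (n mod 12) mod 4" by (simp add: mod_mod_cancel)
    then have "n mod 4 = 3" using n(1) by auto
    \<comment> \<open>From \<open>4 * n \<ge> t - a - 31\<close> and \<open>t > 5 * a + 160\<close>
      one gets \<open>5 * n \<ge> t\<close>, which is \<open>t - 4 * n \<le> n\<close>.\<close>
    have bounds: "a \<le> n" "n < t" "4 * n \<le> t" "a \<le> t - 4 * n" "t - 4 * n \<le> n" "t - 4 * n < t"
      using q n False by linarith+
    have "(t - 4 * n) mod 4 = t mod 4"
      using bounds(3) by (metis le_add_diff_inverse mod_mult_self2 add.commute)
    then have "admissible n" "admissible (t - 4 * n)"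
      using less.IH[of n] less.IH[of "t - 4 * n"] bounds \<open>n mod 4 = 3\<close> less.prems by auto
    then have "admissible (4 * n + (t - 4 * n))"
      using n bounds by (intro admissible_quintuple coprime_6) auto
    then show ?thesis using bounds(3) by simp
  qed
qed

section \<open>Cyclic constructions\<close>

text \<open>The remaining ingredients are invariant under the cyclic group of order \<open>n\<close>. The point
  \<open>(x, i)\<close> of \<open>\<int>/n \<times> {0, 1, 2}\<close> is encoded as \<open>3 * x + i\<close>, so the group acts by addition of
  multiples of \<open>3\<close> modulo \<open>3 * n\<close>; it fixes the points \<open>3 * n, \<dots>, 3 * n + 7\<close> of the hole.\<close>
definition shift :: "nat \<Rightarrow> nat \<Rightarrow> nat \<Rightarrow> nat" where
  "shift n t p = (if p < 3 * n then (p + 3 * t) mod (3 * n) else p)"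

text \<open>Representatives of the short block orbits, which consist of the cosets of the subgroup of
  order \<open>4\<close> of \<open>\<int>/3n\<close>.\<close>
definition quad :: "nat \<Rightarrow> nat \<Rightarrow> nat list" where
  "quad n i = map (\<lambda>j. i + j * (3 * (n div 4))) [0, 1, 2, 3]"

text \<open>The blocks through the point \<open>i < 3\<close>.\<close>
definition rows :: "nat \<Rightarrow> nat list list \<Rightarrow> nat \<Rightarrow> nat list list" where
  "rows n base i =
     [map (shift n (n - p div 3)) b. b \<leftarrow> base, p \<leftarrow> b, p < 3 * n \<and> p mod 3 = i] @
     (if 4 dvd n then [quad n i] else [])"

lemma shift_shift: "shift n a (shift n b w) = shift n (a + b) w"
proof (cases "w < 3 * n")
  case True
  then have "(w + 3 * b) mod (3 * n) < 3 * n" by simp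
  then show ?thesis using True
    by (simp add: shift_def mod_simps algebra_simps)
qed (simp add: shift_def)

lemma shift_0: "shift n 0 w = w"
  by (simp add: shift_def)

lemma shift_less_iff: "shift n t w < 3 * n \<longleftrightarrow> w < 3 * n"
  by (auto simp: shift_def)

lemma shift_less: "w < 3 * n + 8 \<Longrightarrow> shift n t w < 3 * n + 8"
  by (metis shift_def shift_less_iff trans_less_add1)

lemma shift_mod: "shift n (t mod n) w = shift n t w"
proof -
  have "(w + 3 * (t mod n)) mod (3 * n) = (w + 3 * t) mod (3 * n)"
    by (simp only: mult_mod_right mod_add_right_eq)
  then show ?thesis by (simp add: shift_def)
qed

lemma shift_inverse: "t \<le> n \<Longrightarrow> shift n t (shift n (n - t) w) = w"
  by (simp add: shift_shift) (simp add: shift_def)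

lemma shift_inverse': "t \<le> n \<Longrightarrow> shift n (n - t) (shift n t w) = w"
  by (simp add: shift_shift) (simp add: shift_def)

lemma inj_shift: "inj (shift n t)"
proof (cases "n = 0")
  case False
  then have "shift n (n - t mod n) (shift n t w) = w" for w
    using shift_inverse'[of "t mod n" n w] by (simp add: shift_mod less_imp_le)
  then show ?thesis by (metis injI)
qed (simp add: shift_def inj_def)

lemma shift_div_mod:
  assumes "u < 3 * n"
  shows "shift n s u div 3 = (u div 3 + s) mod n" "shift n s u mod 3 = u mod 3"
  using assms by (simp_all add: shift_def mod_mult2_eq add.commute)

lemma shift_div_3: "u < 3 * n \<Longrightarrow> shift n (shift n s u div 3) w = shift n s (shift n (u div 3) w)"
  by (simp add: shift_div_mod shift_mod shift_shift add.commute)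

lemma shift_base: "x < 3 * n \<Longrightarrow> shift n (x div 3) (x mod 3) = x"
  by (simp add: shift_def)

text \<open>For \<open>n = 4 * e\<close> and \<open>p = i + 3 * (j * e)\<close> the shift is by
  \<open>j * e\<close>, which sends index \<open>k\<close> to \<open>k + j\<close> modulo 4. Hence
  the short orbit gives just one block through \<open>i\<close>.\<close>

lemma shift_quad:
  assumes "4 dvd n" "i < 3" "p \<in> set (quad n i)"
  shows "shift n (p div 3) ` set (quad n i) = set (quad n i)"
proof -
  obtain e where n: "n = 4 * e" using assms(1) by blast
  have quad: "set (quad n i) = (\<lambda>j. i + j * (3 * e)) ` {0, 1, 2, 3}"
    by (simp add: quad_def n)
  then obtain j where j: "j \<in> {0, 1, 2, 3}" "p = i + j * (3 * e)"
    using assms(3) by blast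
  have "p = i + 3 * (j * e)" using j(2) by simp
  then have p: "p div 3 = j * e" using assms(2) by simp
  have "shift n (p div 3) (i + k * (3 * e)) = i + ((k + j) mod 4) * (3 * e)" if "k \<in> {0, 1, 2, 3}" for k
  proof (cases "e = 0")
    case False
    have lt: "i + l * (3 * e) < 12 * e" if "l < 4" for l
    proof -
      have "l * (3 * e) \<le> 3 * (3 * e)" using that by (intro mult_right_mono) auto
      then show ?thesis using assms(2) False by linarith
    qed
    have "shift n (p div 3) (i + k * (3 * e)) = (i + k * (3 * e) + 3 * (j * e)) mod (12 * e)"
    proof -
      have "k < 4" using that by auto
      then have "i + k * (3 * e) < 12 * e" by (rule lt)
      then show ?thesis by (simp add: shift_def n p)
    qed
    also have "i + k * (3 * e) + 3 * (j * e) = i + (k + j) * (3 * e)" by (simp add: algebra_simps)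
    also have "\<dots> = i + ((k + j) mod 4 + 4 * ((k + j) div 4)) * (3 * e)" by simp
    also have "\<dots> = i + ((k + j) mod 4) * (3 * e) + ((k + j) div 4) * (12 * e)"
      unfolding add_mult_distrib by simp
    also have "\<dots> mod (12 * e) = (i + ((k + j) mod 4) * (3 * e)) mod (12 * e)"
      by (rule mod_mult_self1)
    also have "\<dots> = i + ((k + j) mod 4) * (3 * e)" by (simp add: lt)
    finally show ?thesis .
  qed (simp add: n shift_def)
  then have "shift n (p div 3) ` set (quad n i) = (\<lambda>k. i + ((k + j) mod 4) * (3 * e)) ` {0, 1, 2, 3}"
    unfolding quad image_image by (rule image_cong[OF refl])
  also have "\<dots> = set (quad n i)" using j(1) unfolding quad by auto
  finally show ?thesis .
qed

lemma quad_mod_3: "i < 3 \<Longrightarrow> p \<in> set (quad n i) \<Longrightarrow> p mod 3 = i"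
proof -
  assume "i < 3" "p \<in> set (quad n i)"
  moreover from this obtain j where "p = i + j * (3 * (n div 4))" unfolding quad_def by force
  then have "p = i + 3 * (j * (n div 4))" by simp
  ultimately show ?thesis by simp
qed

text \<open>The list \<open>N ! i\<close> consists of the points that are not collinear with \<open>i\<close>. If two points had
  the same opposite line, they would lie on a 4-cycle of the non-collinearity graph.\<close>
locale starter =
  fixes n :: nat and N base :: "nat list list"
  assumes n_pos: "n > 0"
    and base_distinct: "\<And>b. b \<in> set base \<Longrightarrow> distinct b"
    and base_length: "\<And>b. b \<in> set base \<Longrightarrow> length b = 4"
    and base_less: "\<And>b p. b \<in> set base \<Longrightarrow> p \<in> set b \<Longrightarrow> p < 3 * n + 8"
    and base_hole: "\<And>b p q. \<lbrakk>b \<in> set base; p \<in> set b; q \<in> set b; 3 * n \<le> p; 3 * n \<le> q\<rbrakk> \<Longrightarrow> p = q"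
    and N_base: "\<And>i. i < 3 \<Longrightarrow> N ! i \<in> set base"
    and N_less: "\<And>i p. i < 3 \<Longrightarrow> p \<in> set (N ! i) \<Longrightarrow> p < 3 * n"
    and rows_distinct: "\<And>i. i < 3 \<Longrightarrow> distinct (concat (map (removeAll i) (rows n base i)) @ N ! i)"
    and rows_cover: "\<And>i. i < 3 \<Longrightarrow>
      set (concat (map (removeAll i) (rows n base i)) @ N ! i) = {..<3 * n + 8} - {i}"
    and no_4_cycle: "\<And>i. i < 3 \<Longrightarrow> distinct (concat
      (map (\<lambda>q. removeAll i (map (shift n (q div 3)) (N ! (q mod 3)))) (N ! i)))"
begin

text \<open>Counting incidences, \<open>3 * n * (n + 1)\<close> in all and \<open>24 * n\<close> of
  them in blocks that meet the hole, leaves \<open>3 * n * (n - 7) / 4\<close> blocks inside the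
  moved points. This is a multiple of \<open>n\<close> if \<open>n\<close> is 3 modulo 4 but not if
  4 divides \<open>n\<close>; three short orbits of length \<open>n / 4\<close> then account for the
  difference.\<close>

definition blocks :: "nat set set" where
  "blocks = {shift n t ` set b | t b. b \<in> set base \<or> 4 dvd n \<and> b \<in> quad n ` {..<3}}"

lemma blocksI: "b \<in> set base \<or> 4 dvd n \<and> b \<in> quad n ` {..<3} \<Longrightarrow> shift n t ` set b \<in> blocks"
  unfolding blocks_def by blast

lemma blocksE:
  assumes "c \<in> blocks"
  obtains t b where "c = shift n t ` set b" "b \<in> set base"
  | t i where "c = shift n t ` set (quad n i)" "4 dvd n" "i < 3"
  using assms unfolding blocks_def by blast

lemma mem_rows: "i < 3 \<Longrightarrow> r \<in> set (rows n base i) \<Longrightarrow> i \<in> set r"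
proof -
  assume i: "i < 3" and r: "r \<in> set (rows n base i)"
  have "shift n (n - p div 3) p = i" if "p < 3 * n" "p mod 3 = i" for p
  proof -
    have "shift n (n - p div 3) (shift n (p div 3) i) = i"
      using that by (intro shift_inverse') linarith
    then show ?thesis using shift_base[of p n] that by simp
  qed
  note p = this
  consider b p where "p \<in> set b" "p < 3 * n" "p mod 3 = i" "r = map (shift n (n - p div 3)) b"
    | "r = quad n i"
    using r by (auto simp: rows_def split: if_splits)
  then show ?thesis
  proof cases
    case (1 b p)
    then have "shift n (n - p div 3) p \<in> set r" by simp
    then show ?thesis using p[OF 1(2,3)] by simp
  next
    case 2
    then show ?thesis by (simp add: quad_def)
  qed
qed

text \<open>This reduces all moved points to the representatives 0, 1, 2, whose rows are checked by
  computation. For a short orbit the two shifts may differ, by an element that fixes the coset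
  according to \<open>shift_quad\<close>.\<close>

lemma block_row:
  assumes c: "c \<in> blocks" and x: "x \<in> c" "x < 3 * n"
  obtains r where "r \<in> set (rows n base (x mod 3))" "c = shift n (x div 3) ` set r"
  using c
proof (cases rule: blocksE)
  case (1 t b)
  then obtain p where p: "p \<in> set b" "x = shift n t p" using x by blast
  then have pl: "p < 3 * n" using x shift_less_iff by blast
  let ?r = "map (shift n (n - p div 3)) b"
  have "x mod 3 = p mod 3" using shift_div_mod[OF pl] p by simp
  then have "?r \<in> set (rows n base (x mod 3))"
    using 1(2) p(1) pl by (auto simp: rows_def)
  moreover have "shift n (x div 3) (shift n (n - p div 3) q) = shift n t q" for q
    using shift_div_3[OF pl, of t] shift_inverse[of "p div 3" n q] pl p(2) by simp
  then have "c = shift n (x div 3) ` set ?r" using 1(1) by (simp add: image_image)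
  ultimately show thesis by (rule that)
next
  case (2 t i)
  then obtain p where p: "p \<in> set (quad n i)" "x = shift n t p" using x by blast
  then have pl: "p < 3 * n" using x shift_less_iff by blast
  have "p mod 3 = i" using quad_mod_3 p(1) 2 by simp
  then have "x mod 3 = i" using shift_div_mod[OF pl] p by simp
  then have "quad n i \<in> set (rows n base (x mod 3))" using 2 by (simp add: rows_def)
  moreover have "c = shift n (x div 3) ` set (quad n i)"
  proof -
    have "shift n (x div 3) ` set (quad n i) = shift n t ` shift n (p div 3) ` set (quad n i)"
      using shift_div_3[OF pl, of t] p(2) by (simp add: image_image)
    then show ?thesis using shift_quad[OF 2(2,3) p(1)] 2(1) by simp
  qed
  ultimately show thesis by (rule that)
qed

lemma row_block:
  assumes "r \<in> set (rows n base i)" "i < 3"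
  shows "shift n s ` set r \<in> blocks"
proof -
  consider b p where "b \<in> set base" "r = map (shift n (n - p div 3)) b" | "4 dvd n" "r = quad n i"
    using assms(1) by (auto simp: rows_def split: if_splits)
  then show ?thesis
  proof cases
    case (1 b p)
    then have "shift n s ` set r = shift n (s + (n - p div 3)) ` set b"
      by (simp add: image_image shift_shift)
    then show ?thesis using 1(1) blocksI by simp
  next
    case 2
    then show ?thesis using assms(2) by (simp add: blocksI)
  qed
qed

lemma row_unique:
  assumes "i < 3" "r \<in> set (rows n base i)" "r' \<in> set (rows n base i)" "z \<in> set r" "z \<in> set r'" "z \<noteq> i"
  shows "set r = set r'"
proof -
  have "distinct (concat (map (removeAll i) (rows n base i)))"
    using rows_distinct[OF assms(1)] by simp
  then have "removeAll i r = removeAll i r'"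
    using assms unfolding distinct_concat_iff by fastforce
  then have "set r - {i} = set r' - {i}" by (metis set_removeAll)
  then show ?thesis using mem_rows[OF assms(1)] assms(2,3) by blast
qed

lemma block_unique_less:
  assumes "b \<in> blocks" "c \<in> blocks" "x \<in> b" "y \<in> b" "x \<in> c" "y \<in> c" "x \<noteq> y" "x < 3 * n"
  shows "b = c"
proof -
  obtain r where r: "r \<in> set (rows n base (x mod 3))" "b = shift n (x div 3) ` set r"
    using block_row assms by metis
  obtain r' where r': "r' \<in> set (rows n base (x mod 3))" "c = shift n (x div 3) ` set r'"
    using block_row assms by metis
  obtain z where z: "z \<in> set r" "y = shift n (x div 3) z" using assms r by blast
  moreover have "z \<in> set r'" using assms r' z inj_shift by (metis image_iff injD)
  moreover have "z \<noteq> x mod 3" using z assms shift_base[of x n] by metis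
  ultimately show ?thesis using row_unique[of "x mod 3" r r' z] r r' by simp
qed

text \<open>Shifting back by \<open>x div 3\<close> leads to the representative
  \<open>x mod 3\<close>. There the rows and the list in \<open>N\<close> partition all other
  points, so the points on no common block are exactly those of that list.\<close>

lemma nonadjacent_blocks:
  assumes x: "x < 3 * n"
  shows "nonadjacent {..<3 * n + 8} blocks x = shift n (x div 3) ` set (N ! (x mod 3))"
proof (rule set_eqI)
  fix y
  let ?i = "x mod 3" and ?s = "x div 3"
  let ?R = "set (concat (map (removeAll ?i) (rows n base ?i)))"
  have i: "?i < 3" and s: "?s \<le> n" using x by auto
  define z where "z = shift n (n - ?s) y"
  have y: "y = shift n ?s z" using shift_inverse[OF s] by (simp add: z_def)
  have yx: "y = x \<longleftrightarrow> z = ?i"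
    using inj_eq[OF inj_shift, of n ?s z ?i] by (simp only: y[symmetric] shift_base[OF x])
  have yV: "y < 3 * n + 8 \<longleftrightarrow> z < 3 * n + 8"
    using shift_less[of y n "n - ?s"] shift_less[of z n ?s] by (auto simp only: y[symmetric] z_def[symmetric])
  have mem: "y \<in> shift n ?s ` Z \<longleftrightarrow> z \<in> Z" for Z
    unfolding y using inj_shift by (simp add: inj_image_mem_iff)
  have adj: "(\<exists>b\<in>blocks. x \<in> b \<and> y \<in> b) \<longleftrightarrow> (\<exists>r\<in>set (rows n base ?i). z \<in> set r)"
  proof
    assume "\<exists>b\<in>blocks. x \<in> b \<and> y \<in> b"
    then obtain b where b: "b \<in> blocks" "x \<in> b" "y \<in> b" by blast
    obtain r where "r \<in> set (rows n base ?i)" "b = shift n ?s ` set r"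
      using block_row[OF b(1,2) x] .
    then show "\<exists>r\<in>set (rows n base ?i). z \<in> set r" using mem b(3) by blast
  next
    assume "\<exists>r\<in>set (rows n base ?i). z \<in> set r"
    then obtain r where r: "r \<in> set (rows n base ?i)" "z \<in> set r" by blast
    have "x \<in> shift n ?s ` set r" using imageI[OF mem_rows[OF i r(1)], of "shift n ?s"] shift_base[OF x] by simp
    moreover have "y \<in> shift n ?s ` set r" using mem r(2) by simp
    ultimately show "\<exists>b\<in>blocks. x \<in> b \<and> y \<in> b" using row_block[OF r(1) i, of ?s] by blast
  qed
  define R where "R = ?R"
  have R: "z \<in> R \<longleftrightarrow> (\<exists>r\<in>set (rows n base ?i). z \<in> set r) \<and> z \<noteq> ?i"
    unfolding R_def by auto
  have "R \<inter> set (N ! ?i) = {}"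
    using rows_distinct[OF i] unfolding R_def by (simp only: distinct_append)
  moreover have "R \<union> set (N ! ?i) = {..<3 * n + 8} - {?i}"
    using rows_cover[OF i] unfolding R_def by (simp only: set_append)
  ultimately have N: "z \<in> set (N ! ?i) \<longleftrightarrow> z < 3 * n + 8 \<and> z \<noteq> ?i \<and> z \<notin> R"
    by blast
  have "y \<in> nonadjacent {..<3 * n + 8} blocks x \<longleftrightarrow>
      y < 3 * n + 8 \<and> y \<noteq> x \<and> \<not> (\<exists>b\<in>blocks. x \<in> b \<and> y \<in> b)"
    unfolding nonadjacent_def by blast
  also have "\<dots> \<longleftrightarrow> z \<in> set (N ! ?i)" unfolding adj yx yV N R by blast
  finally show "y \<in> nonadjacent {..<3 * n + 8} blocks x \<longleftrightarrow> y \<in> shift n ?s ` set (N ! ?i)"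
    by (simp only: mem)
qed

lemma nonadjacent_shift:
  assumes "x < 3 * n"
  shows "nonadjacent {..<3 * n + 8} blocks (shift n s x) = shift n s ` nonadjacent {..<3 * n + 8} blocks x"
  using assms shift_less_iff[of n s x] by (simp add: nonadjacent_blocks shift_div_mod(2) shift_div_3 image_image)

lemma nonadjacent_sym:
  "x < 3 * n + 8 \<Longrightarrow> y \<in> nonadjacent {..<3 * n + 8} B x \<Longrightarrow> x \<in> nonadjacent {..<3 * n + 8} B y"
  by (auto simp: nonadjacent_def)

text \<open>Noncollinearity is symmetric, so \<open>y\<close> is noncollinear with two entries
  \<open>q\<close> and \<open>q'\<close> of \<open>N ! i\<close> and occurs in the lists of both:
  the 4-cycle \<open>i, q, y, q'\<close> contradicts distinctness.\<close>

lemma nonadjacent_base_eq: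
  assumes i: "i < 3" and y: "y < 3 * n"
    and eq: "nonadjacent {..<3 * n + 8} blocks i = nonadjacent {..<3 * n + 8} blocks y"
  shows "y = i"
proof (rule ccontr)
  assume ne: "y \<noteq> i"
  have il: "i < 3 * n" using i n_pos by simp
  have nb_i: "nonadjacent {..<3 * n + 8} blocks i = set (N ! i)"
    using nonadjacent_blocks[OF il] i by (simp add: shift_0)
  have nb_y: "nonadjacent {..<3 * n + 8} blocks y = set (N ! i)" using eq nb_i by simp
  let ?L = "\<lambda>q. removeAll i (map (shift n (q div 3)) (N ! (q mod 3)))"
  have y_mem: "y \<in> set (?L q)" if q: "q \<in> set (N ! i)" for q
  proof -
    have "q \<in> nonadjacent {..<3 * n + 8} blocks y" unfolding nb_y by (rule q)
    from nonadjacent_sym[OF _ this] have "y \<in> nonadjacent {..<3 * n + 8} blocks q" using y by simp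
    then have "y \<in> shift n (q div 3) ` set (N ! (q mod 3))"
      unfolding nonadjacent_blocks[OF N_less[OF i q]] .
    then show ?thesis using ne by simp
  qed
  have "length (N ! i) = 4" using base_length N_base[OF i] by blast
  then obtain q q' qs where N: "N ! i = q # q' # qs"
    by (cases "N ! i" rule: remdups_adj.cases) auto
  then have "y \<in> set (?L q)" "y \<in> set (?L q')" using y_mem by auto
  moreover have "distinct (concat (map ?L (q # q' # qs)))" using no_4_cycle[OF i] N by simp
  then have "set (?L q) \<inter> set (?L q') = {}"
    by (simp only: list.map concat.simps distinct_append set_append) blast
  ultimately show False by blast
qed

lemma admissible: "admissible n"
proof -
  have V: "{..<3 * n} \<union> {3 * n..<3 * n + 8} = {..<3 * n + 8}" by auto
  have quad_less: "p < 3 * n" if "4 dvd n" "i < 3" "p \<in> set (quad n i)" for p i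
    using that n_pos by (auto simp: quad_def)
  have subset: "b \<subseteq> {..<3 * n + 8}" if "b \<in> blocks" for b
    using that
  proof (cases rule: blocksE)
    case (1 t b')
    then show ?thesis using base_less shift_less by auto
  next
    case (2 t i)
    then show ?thesis using quad_less[OF 2(2,3)] shift_less by (auto simp: trans_less_add1)
  qed
  have "pent_with_hole {..<3 * n} {3 * n..<3 * n + 8} blocks"
  proof (rule pent_with_hole.intro)
    show "b \<subseteq> {..<3 * n} \<union> {3 * n..<3 * n + 8}" if "b \<in> blocks" for b
      unfolding V using subset that .
    show "card b = 4" if "b \<in> blocks" for b
      using that
    proof (cases rule: blocksE)
      case (1 t b')
      then show ?thesis
        using base_length base_distinct by (simp add: card_image inj_on_subset[OF inj_shift] distinct_card)
    next
      case (2 t i)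
      then have "n div 4 > 0" using n_pos by (simp add: dvd_imp_le div_greater_zero_iff)
      then have "distinct (quad n i)" by (auto simp: quad_def)
      then have "card (set (quad n i)) = 4" by (simp add: distinct_card quad_def)
      then show ?thesis using 2(1) by (simp add: card_image inj_on_subset[OF inj_shift])
    qed
    show hole: "x = y" if "b \<in> blocks" and xy: "x \<in> b" "y \<in> b" "x \<in> {3 * n..<3 * n + 8}" "y \<in> {3 * n..<3 * n + 8}"
      for b x y
      using that(1)
    proof (cases rule: blocksE)
      case (1 t b')
      then obtain p q where "p \<in> set b'" "q \<in> set b'" "x = shift n t p" "y = shift n t q" using xy by blast
      moreover from this have "3 * n \<le> p" "3 * n \<le> q"
        using xy shift_less_iff[of n t p] shift_less_iff[of n t q] by auto
      ultimately show ?thesis using base_hole[OF 1(2)] by blast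
    next
      case (2 t i)
      then obtain p where "p \<in> set (quad n i)" "x = shift n t p" using xy by blast
      then have "x < 3 * n" using quad_less[OF 2(2,3)] shift_less_iff by blast
      then show ?thesis using xy by simp
    qed
    show "b = c" if "b \<in> blocks" "c \<in> blocks" "x \<in> b" "y \<in> b" "x \<in> c" "y \<in> c" "x \<noteq> y" for b c x y
    proof -
      have "x < 3 * n + 8" "y < 3 * n + 8" using subset that by blast+
      then have "x < 3 * n \<or> y < 3 * n" using hole[of b x y] that by fastforce
      then show ?thesis
        using block_unique_less[of b c x y] block_unique_less[of b c y x] that by blast
    qed
    show "nonadjacent ({..<3 * n} \<union> {3 * n..<3 * n + 8}) blocks x \<in> blocks"
      if "x \<in> {..<3 * n}" for x
      using that N_base[of "x mod 3"] unfolding V by (simp add: nonadjacent_blocks blocksI)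
    show "nonadjacent ({..<3 * n} \<union> {3 * n..<3 * n + 8}) blocks x \<subseteq> {..<3 * n}"
      if "x \<in> {..<3 * n}" for x
      using that N_less[of "x mod 3"] unfolding V
      by (auto simp: nonadjacent_blocks shift_less_iff)
    show "inj_on (nonadjacent ({..<3 * n} \<union> {3 * n..<3 * n + 8}) blocks) {..<3 * n}"
      unfolding V
    proof (rule inj_onI)
      fix x y assume "x \<in> {..<3 * n}" "y \<in> {..<3 * n}"
        and eq: "nonadjacent {..<3 * n + 8} blocks x = nonadjacent {..<3 * n + 8} blocks y"
      then have xy: "x < 3 * n" "y < 3 * n" by auto
      \<comment> \<open>This shift moves \<open>x\<close> to its orbit representative, the case
        already settled.\<close>
      let ?t = "n - x div 3"
      have "shift n ?t (shift n (x div 3) (x mod 3)) = x mod 3" using xy by (intro shift_inverse') auto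
      then have "shift n ?t x = x mod 3" using shift_base[OF xy(1)] by simp
      moreover have "nonadjacent {..<3 * n + 8} blocks (shift n ?t x) = nonadjacent {..<3 * n + 8} blocks (shift n ?t y)"
        using nonadjacent_shift xy eq by simp
      ultimately have "shift n ?t y = shift n ?t x"
        using nonadjacent_base_eq[of "x mod 3" "shift n ?t y"] xy by (simp add: shift_less_iff)
      then show "x = y" using injD[OF inj_shift] by metis
    qed
  qed auto
  then show ?thesis unfolding admissible_def by blast
qed

end

text \<open>Equality with a sorted list expresses \<open>rows_distinct\<close> and
  \<open>rows_cover\<close> at once and can be evaluated. Hole points are fixed by all shifts and
  must occur once in the rows of each of 0, 1, 2, so the triple attached to a hole point meets all
  three orbits. The lists in \<open>N\<close> are base blocks because opposite lines have to be
  blocks.\<close>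

definition is_starter :: "nat \<Rightarrow> nat list list \<Rightarrow> nat list list \<Rightarrow> nat list list \<Rightarrow> bool" where
  "is_starter n N T B \<longleftrightarrow>
     (let base = N @ B @ map2 (\<lambda>t j. t @ [3 * n + j]) T [0..<8] in
      n > 0 \<and> length N = 3 \<and>
      list_all (\<lambda>b. length b = 4 \<and> distinct b \<and> list_all (\<lambda>p. p < 3 * n) b) (N @ B) \<and>
      list_all (\<lambda>t. length t = 3 \<and> distinct t \<and> list_all (\<lambda>p. p < 3 * n) t) T \<and>
      list_all (\<lambda>i.
        sort (concat (map (removeAll i) (rows n base i)) @ N ! i) = [0..<i] @ [i + 1..<3 * n + 8] \<and>
        distinct (concat (map (\<lambda>q. removeAll i (map (shift n (q div 3)) (N ! (q mod 3)))) (N ! i))))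
      [0, 1, 2])"

lemma admissible_if_starter:
  assumes "is_starter n N T B"
  shows "admissible n"
proof -
  define hb where "hb = map2 (\<lambda>t j. t @ [3 * n + j]) T [0..<8]"
  define base where "base = N @ B @ hb"
  note S = assms[unfolded is_starter_def Let_def, folded hb_def, folded base_def, unfolded list_all_iff]
  have hb: "\<exists>t j. t \<in> set T \<and> j < 8 \<and> b = t @ [3 * n + j]" if b: "b \<in> set hb" for b
  proof -
    obtain t j where tj: "(t, j) \<in> set (zip T [0..<8])" "b = t @ [3 * n + j]"
      using b unfolding hb_def by auto
    then have "t \<in> set T" "j \<in> set [0..<8]" by (blast dest: set_zip_leftD set_zip_rightD)+
    then show ?thesis using tj(2) by auto
  qed
  have full: "length b = 4" "distinct b" "\<forall>p\<in>set b. p < 3 * n" if "b \<in> set N \<union> set B" for b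
    using S that by auto
  have trip: "length t = 3" "distinct t" "\<forall>p\<in>set t. p < 3 * n" if "t \<in> set T" for t
    using S that by auto
  have row: "sort (concat (map (removeAll i) (rows n base i)) @ N ! i) = [0..<i] @ [i + 1..<3 * n + 8]"
    "distinct (concat (map (\<lambda>q. removeAll i (map (shift n (q div 3)) (N ! (q mod 3)))) (N ! i)))"
    if "i < 3" for i
  proof -
    have "i \<in> set [0, 1, 2]" using that by auto
    then show "sort (concat (map (removeAll i) (rows n base i)) @ N ! i) = [0..<i] @ [i + 1..<3 * n + 8]"
      "distinct (concat (map (\<lambda>q. removeAll i (map (shift n (q div 3)) (N ! (q mod 3)))) (N ! i)))"
      using S by blast+
  qed
  interpret starter n N base
  proof
    show "n > 0" using S by blast
    show "length b = 4" "distinct b" if "b \<in> set base" for b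
      using that full[of b] hb[of b] trip unfolding base_def by fastforce+
    show "p < 3 * n + 8" if "b \<in> set base" "p \<in> set b" for b p
      using that full(3)[of b] hb[of b] trip(3) unfolding base_def by fastforce
    show "p = q" if "b \<in> set base" "p \<in> set b" "q \<in> set b" "3 * n \<le> p" "3 * n \<le> q" for b p q
      using that full(3)[of b] hb[of b] trip(3) unfolding base_def by fastforce
    show "N ! i \<in> set base" if "i < 3" for i
      using that S unfolding base_def by auto
    show "p < 3 * n" if "i < 3" "p \<in> set (N ! i)" for i p
      using that S full(3)[of "N ! i"] by auto
    show "distinct (concat (map (removeAll i) (rows n base i)) @ N ! i)" if "i < 3" for i
    proof -
      have "distinct ([0..<i] @ [i + 1..<3 * n + 8])" by auto
      then show ?thesis unfolding row(1)[OF that, symmetric] by (simp only: distinct_sort)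
    qed
    show "set (concat (map (removeAll i) (rows n base i)) @ N ! i) = {..<3 * n + 8} - {i}" if "i < 3" for i
    proof -
      have "set (sort (concat (map (removeAll i) (rows n base i)) @ N ! i)) = {..<3 * n + 8} - {i}"
        unfolding row(1)[OF that] using that by auto
      then show ?thesis by (simp only: set_sort)
    qed
    show "distinct (concat (map (\<lambda>q. removeAll i (map (shift n (q div 3)) (N ! (q mod 3)))) (N ! i)))"
      if "i < 3" for i
      using row(2)[OF that] .
  qed
  show ?thesis by (rule admissible)
qed

section \<open>Explicit starters\<close>

text \<open>Here and below, the first list holds the opposite lines of 0, 1, 2, the second the
  triples completed by the eight hole points, and the third the other base blocks, translated to
  start with an orbit representative.\<close>

lemma admissible_20: "admissible 20"
  by (rule admissible_if_starter[of 20
    "[[19, 46, 11, 32], [42, 15, 41, 44], [22, 19, 51, 30]]"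
    "[[0, 10, 8], [0, 1, 20], [0, 7, 44], [0, 37, 5], [0, 13, 17], [0, 16, 38], [0, 25, 56],
      [0, 40, 35]]"
    "[[1, 2, 8, 50], [0, 3, 12, 53], [0, 14, 23, 47], [0, 6, 42, 4], [1, 7, 43, 17], [0, 34, 43, 55]]"]) code_simp

lemma admissible_23: "admissible 23"
  by (rule admissible_if_starter[of 23
    "[[61, 67, 32, 20], [9, 3, 50, 65], [22, 7, 39, 51]]"
    "[[0, 1, 68], [0, 10, 26], [0, 46, 38], [0, 22, 5], [0, 58, 8], [0, 43, 29], [0, 34, 11],
      [0, 13, 50]]"
    "[[0, 15, 33, 17], [0, 3, 27, 31], [0, 9, 48, 23], [0, 35, 59, 65], [1, 2, 11, 44], [1, 5, 8, 26],
      [1, 19, 43, 32], [0, 16, 19, 49], [0, 7, 55, 64]]"]) code_simp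

lemma admissible_24: "admissible 24"
  by (rule admissible_if_starter[of 24
    "[[1, 22, 71, 44], [0, 51, 38, 8], [37, 67, 3, 30]]"
    "[[0, 10, 20], [0, 31, 62], [0, 67, 14], [0, 61, 23], [0, 43, 11], [0, 49, 53], [0, 19, 35],
      [0, 16, 17]]"
    "[[0, 3, 15, 55], [0, 33, 46, 58], [0, 6, 48, 4], [0, 9, 5, 65], [0, 2, 41, 50], [0, 26, 32, 47],
      [1, 16, 49, 62], [1, 28, 53, 56], [1, 4, 10, 68]]"]) code_simp

lemma admissible_27: "admissible 27"
  by (rule admissible_if_starter[of 27
    "[[3, 78, 58, 68], [24, 31, 52, 26], [58, 77, 8, 15]]"
    "[[0, 49, 32], [0, 1, 29], [0, 40, 11], [0, 25, 5], [0, 16, 50], [0, 46, 35], [0, 31, 38],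
      [0, 10, 47]]"
    "[[0, 18, 4, 70], [0, 9, 42, 69], [0, 24, 19, 41], [0, 15, 13, 59], [0, 36, 73, 8],
      [0, 30, 64, 26], [0, 14, 56, 80], [0, 22, 20, 23], [2, 11, 29, 62], [1, 28, 5, 41],
      [1, 7, 25, 74], [1, 4, 13, 46]]"]) code_simp

lemma admissible_28: "admissible 28"
  by (rule admissible_if_starter[of 28
    "[[51, 33, 1, 38], [0, 40, 46, 2], [1, 20, 68, 48]]"
    "[[0, 7, 17], [0, 19, 50], [0, 31, 35], [0, 10, 53], [0, 61, 83], [0, 16, 77], [0, 64, 32],
      [0, 13, 26]]"
    "[[0, 67, 79, 11], [0, 22, 73, 76], [1, 10, 58, 8], [0, 4, 70, 62], [0, 58, 82, 23],
      [0, 6, 30, 55], [0, 28, 43, 14], [1, 65, 74, 80], [0, 3, 12, 39], [0, 15, 44, 74],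
      [0, 8, 47, 80], [0, 41, 65, 68]]"]) code_simp

lemma admissible_31: "admissible 31"
  by (rule admissible_if_starter[of 31
    "[[87, 6, 25, 14], [69, 61, 34, 86], [10, 26, 71, 81]]"
    "[[0, 34, 44], [0, 1, 65], [0, 76, 11], [0, 79, 92], [0, 10, 47], [0, 7, 53], [0, 37, 80],
      [0, 4, 35]]"
    "[[1, 41, 59, 92], [1, 5, 35, 89], [0, 88, 62, 74], [0, 56, 71, 77], [0, 67, 86, 89],
      [0, 27, 32, 68], [1, 25, 8, 74], [0, 21, 49, 50], [0, 24, 64, 26], [0, 36, 82, 59],
      [0, 9, 39, 52], [0, 3, 45, 78], [0, 16, 55, 91], [0, 61, 70, 73], [1, 7, 49, 79]]"]) code_simp

lemma admissible_32: "admissible 32"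
  by (rule admissible_if_starter[of 32
    "[[3, 93, 40, 68], [57, 79, 19, 20], [79, 23, 77, 30]]"
    "[[0, 67, 2], [0, 13, 92], [0, 46, 38], [0, 88, 35], [0, 16, 29], [0, 34, 50], [0, 82, 11],
      [0, 52, 74]]"
    "[[1, 13, 76, 71], [0, 61, 64, 91], [1, 40, 5, 74], [0, 31, 73, 80], [0, 42, 25, 70],
      [1, 7, 16, 83], [0, 15, 60, 19], [0, 18, 94, 62], [0, 7, 17, 53], [0, 9, 21, 10],
      [1, 53, 56, 86], [0, 27, 57, 83], [0, 20, 32, 77], [0, 33, 23, 41], [0, 5, 14, 95]]"]) code_simp

lemma admissible_35: "admissible 35"
  by (rule admissible_if_starter[of 35
    "[[69, 36, 22, 59], [84, 88, 19, 65], [43, 44, 65, 48]]"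
    "[[0, 82, 77], [0, 28, 41], [0, 85, 38], [0, 103, 92], [0, 94, 56], [0, 31, 74], [0, 43, 62],
      [0, 37, 98]]"
    "[[0, 30, 64, 35], [0, 12, 60, 79], [0, 27, 73, 88], [0, 9, 90, 1], [0, 6, 76, 20],
      [0, 51, 80, 83], [0, 3, 21, 71], [0, 39, 47, 65], [0, 42, 44, 53], [0, 49, 89, 104],
      [0, 13, 25, 52], [0, 7, 10, 55], [1, 10, 31, 82], [1, 43, 26, 74], [1, 8, 53, 80],
      [1, 5, 17, 71], [1, 7, 35, 104], [1, 11, 86, 92]]"]) code_simp

lemma admissible_36: "admissible 36"
  by (rule admissible_if_starter[of 36
    "[[57, 51, 58, 68], [51, 88, 22, 80], [31, 107, 5, 42]]"
    "[[0, 31, 32], [0, 76, 5], [0, 103, 62], [0, 91, 74], [0, 106, 44], [0, 16, 86], [0, 100, 26],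
      [0, 10, 38]]"
    "[[0, 41, 77, 92], [0, 52, 83, 101], [0, 35, 59, 98], [0, 4, 47, 107], [1, 65, 95, 107],
      [1, 16, 20, 41], [0, 67, 80, 89], [0, 3, 23, 56], [0, 9, 96, 104], [1, 10, 40, 17],
      [0, 34, 70, 14], [0, 48, 61, 50], [1, 7, 97, 62], [0, 25, 49, 82], [0, 40, 85, 88],
      [0, 15, 78, 43], [0, 18, 42, 64], [0, 33, 72, 19]]"]) code_simp

lemma admissible_39: "admissible 39"
  by (rule admissible_if_starter[of 39
    "[[57, 60, 22, 59], [96, 67, 52, 116], [4, 77, 44, 60]]"
    "[[0, 67, 68], [0, 31, 14], [0, 43, 53], [0, 115, 95], [0, 16, 86], [0, 76, 11], [0, 85, 71],
      [0, 46, 65]]"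
    "[[1, 14, 107, 113], [2, 11, 62, 83], [0, 1, 23, 62], [0, 36, 83, 110], [0, 21, 26, 113],
      [1, 10, 77, 92], [0, 28, 32, 44], [1, 31, 56, 59], [1, 43, 35, 89], [1, 13, 82, 44],
      [0, 70, 109, 77], [0, 42, 29, 98], [0, 12, 78, 50], [0, 6, 64, 41], [0, 18, 45, 8],
      [0, 30, 49, 55], [0, 15, 69, 52], [0, 7, 34, 91], [0, 40, 94, 112], [0, 9, 33, 13],
      [0, 10, 103, 106]]"]) code_simp

lemma admissible_40: "admissible 40"
  by (rule admissible_if_starter[of 40
    "[[57, 63, 7, 14], [114, 52, 70, 98], [25, 95, 29, 108]]"
    "[[0, 88, 50], [0, 118, 56], [0, 100, 113], [0, 43, 2], [0, 19, 11], [0, 106, 29], [0, 103, 47],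
      [0, 97, 62]]"
    "[[0, 48, 23, 65], [0, 52, 38, 74], [0, 98, 101, 116], [0, 20, 83, 92], [1, 55, 38, 50],
      [1, 56, 62, 95], [1, 11, 35, 110], [0, 40, 8, 59], [1, 16, 97, 68], [0, 45, 73, 89],
      [1, 28, 76, 101], [0, 15, 49, 5], [0, 36, 67, 68], [0, 27, 66, 26], [1, 10, 43, 41],
      [0, 18, 87, 53], [0, 42, 13, 16], [0, 24, 79, 85], [0, 25, 46, 82], [0, 3, 111, 115],
      [0, 21, 10, 22]]"]) code_simp

lemma admissible_43: "admissible 43"
  by (rule admissible_if_starter[of 43
    "[[15, 114, 124, 107], [6, 67, 64, 41], [91, 107, 26, 24]]"
    "[[0, 34, 116], [0, 64, 14], [0, 52, 89], [0, 112, 113], [0, 115, 47], [0, 1, 32], [0, 97, 68],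
      [0, 13, 5]]"
    "[[0, 37, 46, 82], [1, 7, 49, 61], [0, 4, 31, 26], [0, 24, 49, 79], [0, 70, 103, 128],
      [1, 16, 35, 44], [1, 40, 50, 128], [1, 58, 5, 47], [1, 25, 92, 98], [0, 63, 22, 40],
      [0, 27, 19, 127], [0, 42, 7, 85], [0, 48, 76, 17], [1, 8, 53, 110], [0, 54, 16, 29],
      [0, 73, 38, 59], [0, 118, 44, 74], [0, 77, 95, 110], [0, 62, 65, 101], [0, 11, 23, 86],
      [0, 6, 56, 125], [0, 9, 60, 80], [0, 12, 45, 53], [0, 3, 21, 93]]"]) code_simp

lemma admissible_44: "admissible 44"
  by (rule admissible_if_starter[of 44
    "[[18, 114, 58, 116], [75, 109, 25, 128], [7, 125, 11, 18]]"
    "[[0, 43, 104], [0, 106, 8], [0, 37, 92], [0, 16, 101], [0, 103, 41], [0, 67, 26], [0, 127, 35],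
      [0, 124, 113]]"
    "[[1, 13, 14, 38], [2, 5, 83, 95], [1, 43, 8, 110], [0, 42, 20, 65], [1, 22, 44, 116],
      [0, 51, 47, 62], [0, 6, 74, 95], [0, 12, 56, 131], [1, 17, 53, 80], [0, 79, 71, 77],
      [0, 52, 32, 80], [0, 1, 94, 50], [0, 63, 118, 17], [0, 7, 109, 83], [0, 61, 97, 29],
      [0, 54, 13, 59], [0, 24, 88, 38], [0, 49, 112, 122], [0, 9, 93, 31], [0, 21, 4, 19],
      [0, 15, 25, 100], [0, 28, 46, 73], [0, 3, 60, 105], [1, 4, 10, 82]]"]) code_simp

lemma admissible_47: "admissible 47"
  by (rule admissible_if_starter[of 47
    "[[75, 66, 82, 2], [60, 109, 34, 116], [28, 53, 92, 0]]"
    "[[0, 124, 125], [0, 130, 101], [0, 67, 86], [0, 40, 17], [0, 70, 62], [0, 10, 137], [0, 52, 83],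
      [0, 58, 134]]"
    "[[1, 86, 95, 122], [2, 5, 26, 101], [0, 69, 35, 47], [0, 91, 50, 131], [0, 100, 5, 98],
      [0, 60, 29, 59], [1, 40, 50, 68], [0, 11, 74, 80], [0, 34, 89, 104], [1, 70, 38, 92],
      [0, 25, 8, 41], [0, 43, 32, 116], [0, 30, 61, 95], [0, 42, 90, 113], [1, 7, 100, 104],
      [1, 19, 97, 14], [0, 79, 88, 26], [0, 55, 109, 20], [0, 24, 136, 38], [0, 6, 84, 128],
      [0, 18, 114, 94], [0, 21, 54, 118], [0, 3, 129, 1], [0, 36, 22, 73], [0, 39, 4, 85],
      [0, 19, 103, 133], [1, 4, 25, 130]]"]) code_simp

lemma admissible_48: "admissible 48"
  by (rule admissible_if_starter[of 48
    "[[132, 12, 22, 140], [123, 94, 52, 44], [103, 41, 107, 6]]"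
    "[[0, 139, 32], [0, 13, 77], [0, 76, 41], [0, 103, 26], [0, 91, 110], [0, 88, 98], [0, 142, 104],
      [0, 124, 137]]"
    "[[1, 8, 122, 143], [0, 94, 80, 134], [0, 30, 59, 119], [0, 70, 38, 53], [0, 82, 14, 17],
      [0, 5, 68, 116], [1, 34, 29, 35], [1, 17, 74, 86], [0, 43, 95, 113], [0, 56, 83, 107],
      [0, 100, 2, 47], [1, 67, 23, 125], [1, 16, 115, 104], [0, 37, 55, 86], [0, 39, 67, 20],
      [0, 18, 63, 62], [0, 60, 46, 71], [0, 9, 57, 131], [1, 7, 91, 62], [0, 27, 102, 50],
      [0, 3, 54, 61], [0, 66, 31, 40], [0, 33, 49, 52], [0, 1, 25, 64], [0, 4, 79, 136],
      [0, 6, 21, 127], [0, 85, 112, 133]]"]) code_simp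

lemma admissible_51: "admissible 51"
  by (rule admissible_if_starter[of 51
    "[[117, 36, 31, 23], [123, 43, 112, 143], [13, 17, 140, 132]]"
    "[[0, 121, 77], [0, 40, 122], [0, 136, 119], [0, 61, 113], [0, 16, 35], [0, 79, 86], [0, 25, 2],
      [0, 43, 149]]"
    "[[1, 41, 62, 149], [0, 65, 143, 146], [0, 46, 32, 71], [0, 68, 128, 152], [0, 33, 116, 134],
      [1, 28, 71, 122], [1, 52, 65, 119], [1, 55, 104, 113], [0, 91, 14, 125], [0, 69, 26, 74],
      [1, 58, 74, 86], [0, 106, 50, 107], [0, 17, 53, 80], [0, 42, 131, 137], [0, 18, 29, 62],
      [0, 4, 70, 41], [1, 13, 130, 23], [0, 13, 94, 92], [0, 85, 145, 47], [0, 48, 124, 104],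
      [0, 7, 10, 98], [0, 30, 49, 58], [0, 100, 118, 139], [0, 15, 97, 103], [1, 16, 46, 121],
      [0, 60, 22, 112], [0, 6, 96, 133], [0, 3, 24, 1], [0, 9, 108, 64], [0, 12, 51, 78]]"]) code_simp

lemma admissible_55: "admissible 55"
  by (rule admissible_if_starter[of 55
    "[[87, 78, 157, 50], [9, 157, 10, 29], [139, 125, 44, 117]]"
    "[[0, 109, 71], [0, 145, 119], [0, 103, 68], [0, 28, 29], [0, 94, 101], [0, 46, 164],
      [0, 136, 152], [0, 112, 23]]"
    "[[1, 22, 61, 83], [1, 13, 97, 124], [1, 4, 98, 146], [0, 72, 7, 97], [0, 39, 49, 115],
      [0, 13, 64, 113], [0, 124, 130, 38], [1, 37, 68, 161], [0, 57, 139, 163], [1, 46, 109, 56],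
      [0, 40, 118, 86], [0, 19, 154, 2], [0, 34, 127, 77], [0, 58, 91, 14], [0, 16, 31, 56],
      [0, 73, 121, 65], [0, 6, 61, 95], [0, 160, 47, 158], [1, 5, 92, 107], [1, 104, 137, 155],
      [0, 142, 41, 62], [0, 42, 117, 85], [0, 15, 129, 52], [0, 18, 102, 4], [0, 60, 11, 17],
      [0, 12, 110, 155], [0, 21, 54, 161], [0, 3, 141, 35], [0, 45, 26, 125], [0, 30, 99, 83],
      [0, 44, 104, 134], [0, 5, 74, 131], [2, 5, 14, 143]]"]) code_simp

lemma admissible_67: "admissible 67"
  by (rule admissible_if_starter[of 67
    "[[87, 114, 34, 146], [168, 193, 10, 89], [115, 143, 62, 57]]"
    "[[0, 10, 29], [0, 196, 128], [0, 7, 38], [0, 46, 101], [0, 97, 137], [0, 109, 125], [0, 73, 41],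
      [0, 172, 179]]"
    "[[0, 4, 199, 161], [1, 16, 58, 172], [0, 37, 91, 152], [0, 96, 55, 190], [0, 40, 88, 178],
      [0, 36, 64, 187], [1, 76, 68, 140], [1, 40, 100, 74], [1, 22, 11, 59], [1, 73, 167, 197],
      [0, 21, 1, 13], [0, 22, 103, 44], [0, 3, 52, 169], [1, 94, 44, 179], [0, 12, 142, 175],
      [0, 118, 154, 98], [0, 16, 85, 134], [0, 57, 124, 127], [1, 97, 26, 200], [0, 106, 133, 14],
      [1, 25, 71, 161], [1, 52, 5, 173], [0, 45, 76, 62], [0, 6, 126, 145], [0, 33, 115, 116],
      [0, 157, 8, 140], [0, 79, 92, 185], [0, 78, 61, 188], [0, 100, 176, 200], [0, 24, 136, 26],
      [0, 66, 143, 155], [0, 18, 129, 182], [0, 42, 93, 113], [0, 60, 50, 107], [0, 23, 119, 173],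
      [0, 65, 68, 74], [0, 56, 131, 170], [0, 11, 95, 194], [0, 69, 104, 149], [0, 9, 171, 167],
      [0, 15, 99, 153], [2, 17, 140, 182]]"]) code_simp

section \<open>The admissible numbers\<close>

text \<open>A run may start here and still continue one that ends at \<open>b\<close>: after a
  multiple of 4 the next two residues carry no claim.\<close>

definition run_succ :: "nat \<Rightarrow> nat" where
  "run_succ b = (if b mod 4 = 0 then b + 3 else b + 1)"

lemma admissible_run_merge:
  assumes ab: "admissible_run a b" and xy: "admissible_run x y" and "x \<le> run_succ b" "a \<le> run_succ y"
  shows "admissible_run (min a x) (max b y)"
  unfolding admissible_run_def
proof (intro ballI impI)
  fix t assume t: "t \<in> {min a x..max b y}" and mod: "t mod 4 = 0 \<or> t mod 4 = 3"
  have gap: "t \<ge> run_succ c" if "c < t" for c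
  proof (rule ccontr)
    assume "\<not> run_succ c \<le> t"
    then have "c mod 4 = 0" "t = c + 1 \<or> t = c + 2"
      using that by (auto simp: run_succ_def split: if_splits)
    then have "t mod 4 = 1 \<or> t mod 4 = 2" by presburger
    then show False using mod by auto
  qed
  have "t \<in> {a..b} \<or> t \<in> {x..y}"
  proof (cases "t \<le> b")
    case True
    then show ?thesis using gap[of y] assms(4) t by fastforce
  next
    case False
    then show ?thesis using gap[of b] assms(3) t by fastforce
  qed
  then show "admissible t"
    using mod bspec[OF ab[unfolded admissible_run_def], of t]
      bspec[OF xy[unfolded admissible_run_def], of t] by metis
qed

text \<open>The new run grows as it absorbs members in a single pass, so members skipped earlier may
  end up touching it. Only soundness is claimed, and the final check needs one run around the
  target.\<close>

fun add_run :: "nat \<times> nat \<Rightarrow> (nat \<times> nat) list \<Rightarrow> (nat \<times> nat) list" where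
  "add_run (a, b) [] = [(a, b)]"
| "add_run (a, b) ((x, y) # rs) =
     (if x \<le> run_succ b \<and> a \<le> run_succ y then add_run (min a x, max b y) rs
      else (x, y) # add_run (a, b) rs)"

definition in_runs :: "(nat \<times> nat) list \<Rightarrow> nat \<Rightarrow> nat \<Rightarrow> bool" where
  "in_runs rs a b \<longleftrightarrow> list_ex (\<lambda>(x, y). x \<le> a \<and> b \<le> y) rs"

text \<open>The guard repeats the side conditions of \<open>admissible_run_step\<close>. An
  unjustified step discards everything, so soundness holds for any step list and a faulty one fails
  the final \<open>in_runs\<close> test.\<close>

fun extend_runs :: "(nat \<times> nat) list \<Rightarrow> (nat \<times> nat \<times> nat \<times> nat) list \<Rightarrow> (nat \<times> nat) list" where
  "extend_runs rs [] = rs"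
| "extend_runs rs ((c, d, a, b) # ss) =
     (if in_runs rs c d \<and> in_runs rs a b \<and> b \<le> c \<and> c \<le> d \<and>
         (c mod 12 = 7 \<or> c mod 12 = 11) \<and> (d mod 12 = 7 \<or> d mod 12 = 11) \<and> (c = d \<or> a + 31 \<le> b)
      then extend_runs (add_run (4 * c + a, 4 * d + b) rs) ss else [])"

definition admissible_runs :: "(nat \<times> nat) list \<Rightarrow> bool" where
  "admissible_runs rs \<longleftrightarrow> (\<forall>(x, y)\<in>set rs. admissible_run x y)"

lemma admissible_runs_add:
  "admissible_run a b \<Longrightarrow> admissible_runs rs \<Longrightarrow> admissible_runs (add_run (a, b) rs)"
  by (induction "(a, b)" rs arbitrary: a b rule: add_run.induct)
    (auto simp: admissible_runs_def admissible_run_merge)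

lemma admissible_runs_in:
  "admissible_runs rs \<Longrightarrow> in_runs rs a b \<Longrightarrow> admissible_run a b"
  by (auto simp: admissible_runs_def in_runs_def list_ex_iff intro: admissible_run_subset)

lemma admissible_runs_extend:
  "admissible_runs rs \<Longrightarrow> admissible_runs (extend_runs rs ss)"
proof (induction rs ss rule: extend_runs.induct)
  case (2 rs c d a b ss)
  show ?case
  proof (cases "in_runs rs c d \<and> in_runs rs a b \<and> b \<le> c \<and> c \<le> d \<and>
      (c mod 12 = 7 \<or> c mod 12 = 11) \<and> (d mod 12 = 7 \<or> d mod 12 = 11) \<and> (c = d \<or> a + 31 \<le> b)")
    case True
    then have "admissible_run (4 * c + a) (4 * d + b)"
      using admissible_run_step admissible_runs_in[OF 2(2)] by simp
    then show ?thesis using 2 True admissible_runs_add by simp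
  next
    case False
    then show ?thesis by (simp only: extend_runs.simps if_False) (simp add: admissible_runs_def)
  qed
qed simp

lemma admissible_runs_singletons:
  "\<forall>n\<in>set ns. admissible n \<Longrightarrow> admissible_runs rs \<Longrightarrow> admissible_runs (fold (\<lambda>n. add_run (n, n)) ns rs)"
  by (induction ns arbitrary: rs) (auto simp: admissible_runs_add admissible_run_def)

definition seeds :: "nat list" where
  "seeds = [0, 20, 23, 24, 27, 28, 31, 32, 35, 36, 39, 40, 43, 44, 47, 48, 51, 55, 67]"

text \<open>A step \<open>(c, d, a, b)\<close> applies the quintupling to all \<open>n\<close> in \<open>c..d\<close> and \<open>m\<close> in \<open>a..b\<close>. The list
  was generated by a greedy search backwards from the target interval.\<close>
definition steps :: "(nat \<times> nat \<times> nat \<times> nat) list" where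
  "steps =
    [(23, 23, 20, 23), (31, 31, 20, 31), (35, 35, 20, 35), (47, 47, 0, 0), (43, 43, 20, 43),
     (47, 47, 20, 47), (55, 55, 20, 51), (55, 55, 55, 55), (67, 67, 20, 51),
     (67, 67, 55, 55), (67, 67, 67, 67), (115, 115, 20, 51), (115, 115, 55, 55),
     (115, 115, 115, 115), (151, 155, 20, 51), (163, 175, 20, 51), (163, 163, 160, 163),
     (199, 235, 20, 51), (211, 211, 144, 155), (203, 203, 188, 188), (203, 203, 192, 203),
     (247, 271, 20, 51), (235, 235, 192, 235), (247, 271, 192, 223), (323, 323, 20, 51),
     (275, 275, 240, 271), (295, 299, 192, 232), (295, 319, 240, 271), (335, 335, 192, 232),
     (319, 319, 288, 319), (323, 323, 288, 319), (487, 511, 20, 51), (515, 515, 20, 51),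
     (487, 487, 160, 175), (491, 491, 160, 175), (487, 503, 192, 232), (487, 511, 288, 319),
     (575, 575, 160, 175), (499, 499, 480, 499), (575, 575, 192, 223), (511, 511, 480, 511),
     (631, 739, 20, 51), (631, 739, 480, 511), (815, 955, 192, 227), (1007, 1175, 20, 51),
     (1183, 1199, 20, 51), (1007, 1175, 812, 1000), (1183, 1307, 812, 1000),
     (1315, 1607, 812, 1000), (1495, 1607, 1451, 1491), (1975, 2083, 20, 51),
     (1975, 2347, 480, 511), (2467, 3103, 20, 51)]"

lemma admissible_run_2460: "admissible_run 2460 (5 * 2460 + 160)"
proof (rule admissible_runs_in)
  have "\<forall>n\<in>set seeds. admissible n"
    using admissible_0 admissible_20 admissible_23 admissible_24 admissible_27
      admissible_28 admissible_31 admissible_32 admissible_35 admissible_36 admissible_39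
      admissible_40 admissible_43 admissible_44 admissible_47 admissible_48 admissible_51
      admissible_55 admissible_67
    by (simp add: seeds_def)
  then have "admissible_runs (fold (\<lambda>n. add_run (n, n)) seeds [])"
    by (rule admissible_runs_singletons) (simp add: admissible_runs_def)
  then show "admissible_runs (extend_runs (fold (\<lambda>n. add_run (n, n)) seeds []) steps)"
    by (rule admissible_runs_extend)
  \<comment> \<open>The lower end is reached as \<open>4 * 575 + 160 = 2460\<close>; the last step
    ends at \<open>4 * 3103 + 51 = 12463\<close>, just beyond the required 12460.\<close>
  show "in_runs (extend_runs (fold (\<lambda>n. add_run (n, n)) seeds []) steps) 2460 (5 * 2460 + 160)"
    unfolding steps_def seeds_def by code_simp
qed

theorem theorem3p3:
  fixes r :: nat
  assumes "r > 9172"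
    and "r mod 4 = 0 \<or> r mod 4 = 1"
  shows "\<exists>(points :: nat set) lines. pentagonal_geometry points lines 4 r \<and>
           card (partial_linear_space.opposite_line_pairs points lines) = 1"
proof -
  define t where "t = r - 1"
  then have r: "r = t + 1" using assms(1) by simp
  have "t mod 4 = 0 \<or> t mod 4 = 3"
    using assms(2) unfolding r by presburger
  then have "admissible t"
    using admissible_run_unbounded[OF admissible_run_2460] assms(1) r by simp
  then show ?thesis unfolding r by (rule admissible_imp_pentagonal_geometry)
qed

end
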